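(* Let $G$ be a finite, simple, connected graph. Then the great shadow $S(G)$ is planar if and only if $G$ is a bipartite cactus graph.
   Context: All graphs are finite, simple and loopless. For a graph $G$ with vertex set $V$, the great shadow $S(G)$ is the graph on $2|V|$ vertices obtained from $G$ by adding, for each vertex $v$ of $G$, a new vertex $v'$ (the shadow vertex of $v$) and making $v'$ adjacent to $v$ and to every neighbor of $v$ in $G$; no other edges are added (in particular, two shadow vertices are never adjacent). A cactus graph is a graph in which no two cycles share an edge (equivalently, every 2-connected component is a cycle). A bipartite cactus is a cactus graph that is bipartite, i.e. all its cycles have even length. *)

theory Defs
  imports "HOL-Analysis.Analysis"
begin

text \<open>A finite simple graph is given by a vertex set V and a symmetric, irreflexive
adjacency relation E whose edges lie inside V.\<close>

definition simple_graph :: "'a set \<Rightarrow> ('a \<Rightarrow> 'a \<Rightarrow> bool) \<Rightarrow> bool" where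
  "simple_graph V E \<longleftrightarrow> finite V \<and>
     (\<forall>u v. E u v \<longrightarrow> u \<in> V \<and> v \<in> V \<and> u \<noteq> v \<and> E v u)"

definition connected_graph :: "'a set \<Rightarrow> ('a \<Rightarrow> 'a \<Rightarrow> bool) \<Rightarrow> bool" where
  "connected_graph V E \<longleftrightarrow> V \<noteq> {} \<and>
     (\<forall>u\<in>V. \<forall>v\<in>V. (u, v) \<in> {(x, y). E x y}\<^sup>*)"

text \<open>Great shadow: original vertices Inl v, shadow vertices Inr v.\<close>

definition shadow_verts :: "'a set \<Rightarrow> ('a + 'a) set" where
  "shadow_verts V = Inl ` V \<union> Inr ` V"

fun shadow_adj :: "'a set \<Rightarrow> ('a \<Rightarrow> 'a \<Rightarrow> bool) \<Rightarrow> 'a + 'a \<Rightarrow> 'a + 'a \<Rightarrow> bool" where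
  "shadow_adj V E (Inl u) (Inl v) = E u v"
| "shadow_adj V E (Inl u) (Inr v) = (E u v \<or> (u = v \<and> u \<in> V))"
| "shadow_adj V E (Inr u) (Inl v) = (E u v \<or> (u = v \<and> u \<in> V))"
| "shadow_adj V E (Inr u) (Inr v) = False"

text \<open>Planarity: a drawing in the plane (complex numbers) with distinct points for vertices
and arcs for edges, where an arc passes through no other vertex and two arcs of distinct edges
meet only in common end vertices.\<close>

definition planar :: "'v set \<Rightarrow> ('v \<Rightarrow> 'v \<Rightarrow> bool) \<Rightarrow> bool" where
  "planar V E \<longleftrightarrow> (\<exists>(f :: 'v \<Rightarrow> complex) (g :: 'v \<Rightarrow> 'v \<Rightarrow> real \<Rightarrow> complex).
     inj_on f V \<and>
     (\<forall>u v. E u v \<longrightarrow> arc (g u v) \<and> pathstart (g u v) = f u \<and> pathfinish (g u v) = f v) \<and>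
     (\<forall>u v w. E u v \<and> w \<in> V \<and> w \<noteq> u \<and> w \<noteq> v \<longrightarrow> f w \<notin> path_image (g u v)) \<and>
     (\<forall>u v x y. E u v \<and> E x y \<and> {u, v} \<noteq> {x, y} \<longrightarrow>
        path_image (g u v) \<inter> path_image (g x y) \<subseteq> f ` ({u, v} \<inter> {x, y})))"

text \<open>Cycles as lists of at least 3 distinct vertices, cyclically consecutive ones adjacent.\<close>

definition is_cycle :: "('a \<Rightarrow> 'a \<Rightarrow> bool) \<Rightarrow> 'a list \<Rightarrow> bool" where
  "is_cycle E c \<longleftrightarrow> length c \<ge> 3 \<and> distinct c \<and>
     (\<forall>i < length c. E (c ! i) (c ! ((i + 1) mod length c)))"

definition cycle_edges :: "'a list \<Rightarrow> 'a set set" where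
  "cycle_edges c = {{c ! i, c ! ((i + 1) mod length c)} | i. i < length c}"

text \<open>Cactus: no two (distinct) cycles share an edge.\<close>

definition cactus :: "'a set \<Rightarrow> ('a \<Rightarrow> 'a \<Rightarrow> bool) \<Rightarrow> bool" where
  "cactus V E \<longleftrightarrow> (\<forall>c1 c2. is_cycle E c1 \<and> is_cycle E c2 \<and>
      cycle_edges c1 \<inter> cycle_edges c2 \<noteq> {} \<longrightarrow> cycle_edges c1 = cycle_edges c2)"

definition bipartite :: "'a set \<Rightarrow> ('a \<Rightarrow> 'a \<Rightarrow> bool) \<Rightarrow> bool" where
  "bipartite V E \<longleftrightarrow> (\<exists>col :: 'a \<Rightarrow> bool. \<forall>u v. E u v \<longrightarrow> col u \<noteq> col v)"

definition bipartite_cactus :: "'a set \<Rightarrow> ('a \<Rightarrow> 'a \<Rightarrow> bool) \<Rightarrow> bool" where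
  "bipartite_cactus V E \<longleftrightarrow> cactus V E \<and> bipartite V E"

end

theory Submission
  imports Defs
begin

text \<open>
  Two disjoint chords of a Jordan curve whose end points alternate on it lie on opposite sides of it. Hence in a
  drawing of the great shadow, the shadows of consecutive vertices of a cycle of length at least 4 lie on
  opposite sides of the cycle, so there are no such odd cycles; a triangle yields \<open>K\<^sub>3\<^sub>,\<^sub>3\<close>. If two cycles share an
  edge, there are three internally disjoint paths between two vertices \<open>x\<close> and \<open>y\<close>; take the cycle formed by two of
  them of length at least 2. The third path has to lie on the other side than the shadows of \<open>x\<close> and of \<open>y\<close>. This is
  impossible if the third path has an inner vertex, as the shadow of \<open>x\<close> is adjacent to its first one; and if it is
  an edge, the shadow of \<open>y\<close> also lies on the other side than the path from \<open>x\<close> through its shadow to \<open>y\<close>.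

  Conversely, a connected bipartite cactus is built from a vertex by attaching pendant edges and even cycles
  at single vertices. The great shadow, with some edges subdivided, is drawn on two pages: the vertices on
  the real axis and the edges as parabolas above or below. The edge from \<open>x\<close> to its shadow is subdivided by a vertex
  with one arc on each page, so new vertices placed next to it see both \<open>x\<close> and its shadow, and an ear at \<open>x\<close> fits there.
\<close>

subsection \<open>Theta curves\<close>

text \<open>Nonplanarity is reduced to one side test for two chords with alternating ends. It never
  matters which side is which: a closed curve has only two sides, so a contradiction arises from
  three things that it separates pairwise, or from an odd number of alternations around a cycle. Two
  chords that both run outside are excluded with Janiszewski's theorem, since splitting the inside
  says nothing about them.

  In the converse, a direct arc from \<open>x\<close> to its shadow would occupy one page only,
  whereas an ear has to reach both of them from one spot. Evenness of the cycles enters through the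
  pages. The shadows along an ear alternate between the pages, and for an ear of odd length the
  first and the last shadow are both on the page that shows \<open>x\<close>.\<close>

lemma connected_inside_iff:
  assumes "connected S" "S \<inter> C = {}" "x \<in> S" "y \<in> S"
  shows "x \<in> inside C \<longleftrightarrow> y \<in> inside C"
proof -
  have "connected_component (- C) x y"
    unfolding connected_component_def using assms by (intro exI[of _ S]) auto
  then show ?thesis
    using inside_same_component connected_component_sym by metis
qed

text \<open>Makes the two ends of an arc limit points of its interior, which is how the chord lemmas
  below express that an open chord reaches an arc.\<close>

lemma path_image_subset_closure_endless:
  fixes c :: "real \<Rightarrow> 'a::real_normed_vector"
  assumes "arc c"
  shows "path_image c \<subseteq> closure (path_image c - {pathstart c, pathfinish c})"
proof -
  have "path_image c - {pathstart c, pathfinish c} = c ` {0<..<1}"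
    using assms by (simp add: simple_path_endless arc_imp_simple_path)
  moreover have "c ` closure {0<..<1} \<subseteq> closure (c ` {0<..<1})"
    using assms arc_imp_path
    by (intro image_closure_subset) (auto simp: path_def closure_subset)
  ultimately show ?thesis by (simp add: path_image_def)
qed

locale theta_curve =
  fixes c1 c2 c3 :: "real \<Rightarrow> complex" and p r :: complex
  assumes arcs: "arc c1" "arc c2" "arc c3"
    and starts: "pathstart c1 = p" "pathstart c2 = p" "pathstart c3 = p"
    and finishes: "pathfinish c1 = r" "pathfinish c2 = r" "pathfinish c3 = r"
    and inters: "path_image c1 \<inter> path_image c2 = {p, r}" "path_image c1 \<inter> path_image c3 = {p, r}"
      "path_image c2 \<inter> path_image c3 = {p, r}"
begin

text \<open>The facts below single out the pair \<open>c1\<close>, \<open>c2\<close>; reinterpreting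
  the locale in these orders gives them for the other pairs.\<close>

lemma permute:
  "theta_curve c2 c1 c3 p r" "theta_curve c1 c3 c2 p r" "theta_curve c2 c3 c1 p r"
  "theta_curve c3 c1 c2 p r" "theta_curve c3 c2 c1 p r"
  using arcs starts finishes inters by unfold_locales (auto simp: Int_commute)

lemma ends_distinct: "p \<noteq> r"
  using arcs(1) arc_distinct_ends starts(1) finishes(1) by metis

lemma simple: "simple_path (c1 +++ reversepath c2)"
  "pathfinish (c1 +++ reversepath c2) = pathstart (c1 +++ reversepath c2)"
  "path_image (c1 +++ reversepath c2) = path_image c1 \<union> path_image c2"
  using arcs starts finishes inters
  by (auto intro!: simple_path_join_loop simp: arc_reversepath path_image_join)

lemma closed_images: "closed (path_image c1)" "closed (path_image c2)" "closed (path_image c3)"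
  and compact_images: "compact (path_image c1)" "compact (path_image c2)" "compact (path_image c3)"
  using arcs by (auto simp: closed_arc_image compact_arc_image)

lemma Jordan: "inside (path_image c1 \<union> path_image c2) \<noteq> {}"
  "open (inside (path_image c1 \<union> path_image c2))"
  "connected (inside (path_image c1 \<union> path_image c2))"
  "open (outside (path_image c1 \<union> path_image c2))"
  "connected (outside (path_image c1 \<union> path_image c2))"
  "frontier (inside (path_image c1 \<union> path_image c2)) = path_image c1 \<union> path_image c2"
  using Jordan_inside_outside[OF simple(1,2)] unfolding simple(3) by auto

lemma endless: "connected (path_image c1 - {p, r})" "path_image c1 - {p, r} \<noteq> {}"
  using connected_simple_path_endless[of c1] nonempty_simple_path_endless[of c1] arcs starts finishes
  by (auto simp: arc_imp_simple_path)

lemma closure_inside: "closure (inside (path_image c1 \<union> path_image c2)) \<subseteq>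
    path_image c1 \<union> path_image c2 \<union> inside (path_image c1 \<union> path_image c2)"
  by (intro closure_inside_subset closed_Un closed_images)

lemma split_inside:
  assumes "path_image c3 \<inter> inside (path_image c1 \<union> path_image c2) \<noteq> {}"
  shows "inside (path_image c1 \<union> path_image c2) =
    inside (path_image c1 \<union> path_image c3) \<union> inside (path_image c2 \<union> path_image c3) \<union>
    (path_image c3 - {p, r})"
  using split_inside_simple_closed_curve[of c1 p r c2 c3] assms arcs starts finishes inters ends_distinct
  by (auto simp: arc_imp_simple_path)

text \<open>If no arc ran inside the other two, a point inside \<open>c1 \<union> c3\<close> could be joined to infinity
  off \<open>c2 \<union> c3\<close> and off \<open>c1 \<union> c2\<close>, hence, by Janiszewski, off all three arcs.\<close>

lemma some_arc_inside:
  assumes "path_image c3 \<inter> inside (path_image c1 \<union> path_image c2) = {}"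
  shows "path_image c1 \<inter> inside (path_image c2 \<union> path_image c3) \<noteq> {} \<or>
         path_image c2 \<inter> inside (path_image c1 \<union> path_image c3) \<noteq> {}"
proof (rule ccontr)
  let ?A = "path_image c1" and ?B = "path_image c2" and ?C = "path_image c3"
  assume "\<not> ?thesis"
  then have none: "?A \<inter> inside (?B \<union> ?C) = {}" "?B \<inter> inside (?A \<union> ?C) = {}" by auto
  interpret J13: theta_curve c1 c3 c2 p r by (rule permute)
  interpret J31: theta_curve c3 c1 c2 p r by (rule permute)
  interpret J23: theta_curve c2 c3 c1 p r by (rule permute)
  define I where "I = inside (?A \<union> ?C)"
  obtain u where u: "u \<in> I" using J13.Jordan(1) unfolding I_def by auto
  have I_disj: "I \<inter> ?A = {}" "I \<inter> ?C = {}" "I \<inter> ?B = {}"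
    using inside_no_overlap[of "?A \<union> ?C"] none(2) unfolding I_def by blast+
  \<comment> \<open>\<open>I\<close> is connected and its frontier is \<open>?A \<union> ?C\<close>.
    So one frontier point outside the curve \<open>X \<union> ?B\<close> puts some point of
    \<open>I\<close> outside it, and then all of \<open>I\<close>.\<close>
  have out: "u \<in> outside (X \<union> ?B)"
    if hyp: "y \<in> Y" "y \<notin> X \<union> ?B" "y \<notin> inside (X \<union> ?B)" "Y \<subseteq> ?A \<union> ?C" "open (outside (X \<union> ?B))"
      "I \<inter> X = {}" for X Y y
  proof -
    have "y \<in> outside (X \<union> ?B)"
      using hyp(2,3) inside_Un_outside[of "X \<union> ?B"] by blast
    moreover have "y \<in> closure I"
      using hyp(1,4) J13.Jordan(6) unfolding I_def by (auto simp: frontier_def)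
    ultimately obtain u' where "u' \<in> I" "u' \<in> outside (X \<union> ?B)"
      using hyp(5) by (meson closure_iff_nhds_not_empty disjoint_iff subset_refl)
    then have "u' \<notin> inside (X \<union> ?B)" by (meson disjoint_iff inside_Int_outside)
    moreover have "u \<in> inside (X \<union> ?B) \<longleftrightarrow> u' \<in> inside (X \<union> ?B)"
      by (rule connected_inside_iff[of I]) (use I_disj hyp(6) u \<open>u' \<in> I\<close> J13.Jordan(3) in \<open>auto simp: I_def\<close>)
    ultimately show ?thesis using u I_disj hyp(6) inside_Un_outside[of "X \<union> ?B"] by blast
  qed
  obtain a where "a \<in> ?A - {p, r}" using endless(2) by auto
  then have o1: "u \<in> outside (?C \<union> ?B)"
    using inters none(1) I_disj J23.Jordan(4) by (intro out[of a ?A]) (auto simp: Un_commute)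
  obtain c where "c \<in> ?C - {p, r}" using J31.endless(2) by auto
  then have o2: "u \<in> outside (?A \<union> ?B)"
    using inters assms(1) I_disj Jordan(4) by (intro out[of c ?C]) auto
  have bdd: "bounded (?A \<union> ?B \<union> ?C)"
    using compact_images by (simp add: compact_imp_bounded)
  then obtain w where w: "w \<in> outside (?A \<union> ?B \<union> ?C)"
    using outside_bounded_nonempty[OF bdd] by blast
  have w': "w \<in> outside (?C \<union> ?B)" "w \<in> outside (?A \<union> ?B)" "w \<in> outside (?A \<union> ?C)"
    using w outside_mono[of "?C \<union> ?B" "?A \<union> ?B \<union> ?C"] outside_mono[of "?A \<union> ?B" "?A \<union> ?B \<union> ?C"]
      outside_mono[of "?A \<union> ?C" "?A \<union> ?B \<union> ?C"] by blast+
  have cc: "connected_component (- S) u w" if "connected (outside S)" "u \<in> outside S" "w \<in> outside S" for S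
    unfolding connected_component_def using that inside_Un_outside[of S]
    by (intro exI[of _ "outside S"]) blast
  have "connected_component (- ((?C \<union> ?B) \<union> (?A \<union> ?B))) u w"
  proof (rule Janiszewski)
    have "(?C \<union> ?B) \<inter> (?A \<union> ?B) = ?B" using inters by auto
    then show "connected ((?C \<union> ?B) \<inter> (?A \<union> ?B))" using arcs by (simp add: connected_arc_image)
    show "connected_component (- (?C \<union> ?B)) u w"
      using J23.Jordan(5) o1 w' by (intro cc) (auto simp: Un_commute)
    show "connected_component (- (?A \<union> ?B)) u w"
      using Jordan(5) o2 w' by (intro cc) auto
  qed (auto intro: closed_images compact_images compact_Un closed_Un)
  then have "connected_component (- (?A \<union> ?C)) u w"
    by (rule connected_component_of_subset) auto
  then have "w \<in> inside (?A \<union> ?C)"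
    using u inside_same_component unfolding I_def by blast
  then show False using w' by (meson disjoint_iff inside_Int_outside)
qed

text \<open>A connected set \<open>B\<close> off the theta curve that reaches \<open>c1\<close> and \<open>c2\<close>; it stands for
  an open chord crossing \<open>c3\<close>.\<close>

lemma no_common_inside_chord:
  assumes B: "connected B" "B \<inter> (path_image c1 \<union> path_image c2 \<union> path_image c3) = {}"
    and q: "q \<in> path_image c1 - {p, r}" "q \<in> closure B"
    and s: "s \<in> path_image c2 - {p, r}" "s \<in> closure B"
    and c3: "path_image c3 \<inter> inside (path_image c1 \<union> path_image c2) \<noteq> {}"
    and w: "w \<in> B"
  shows "w \<notin> inside (path_image c1 \<union> path_image c2)"
proof
  let ?A = "path_image c1" and ?B = "path_image c2" and ?C = "path_image c3"
  interpret J13: theta_curve c1 c3 c2 p r by (rule permute)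
  interpret J23: theta_curve c2 c3 c1 p r by (rule permute)
  assume "w \<in> inside (?A \<union> ?B)"
  then have "w \<in> inside (?A \<union> ?C) \<or> w \<in> inside (?B \<union> ?C)"
    using split_inside[OF c3] w B(2) by blast
  \<comment> \<open>\<open>B\<close> cannot leave the half of the inside in which it starts. The
    closure of the half between \<open>c1\<close> and \<open>c3\<close> contains no point of
    \<open>c2\<close> other than \<open>p\<close> and \<open>r\<close>, so \<open>s\<close> is out
    of reach; the other half misses \<open>q\<close> likewise.\<close>
  moreover have "False" if "w \<in> inside (?A \<union> ?C)"
  proof -
    have "B \<subseteq> inside (?A \<union> ?C)"
      using connected_inside_iff[OF B(1), of "?A \<union> ?C" w] w that B(2) by blast
    then have "s \<in> ?A \<union> ?C \<union> inside (?A \<union> ?C)"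
      using s(2) J13.closure_inside closure_mono by blast
    then have "s \<in> inside (?A \<union> ?B)" using s(1) inters split_inside[OF c3] by auto
    then show False using s(1) inside_no_overlap[of "?A \<union> ?B"] by blast
  qed
  moreover have "False" if "w \<in> inside (?B \<union> ?C)"
  proof -
    have "B \<subseteq> inside (?B \<union> ?C)"
      using connected_inside_iff[OF B(1), of "?B \<union> ?C" w] w that B(2) by blast
    then have "q \<in> ?B \<union> ?C \<union> inside (?B \<union> ?C)"
      using q(2) J23.closure_inside closure_mono by blast
    then have "q \<in> inside (?A \<union> ?B)" using q(1) inters split_inside[OF c3] by auto
    then show False using q(1) inside_no_overlap[of "?A \<union> ?B"] by blast
  qed
  ultimately show False by blast
qed

text \<open>Here \<open>c1\<close> splits the inside of \<open>c2 \<union> c3\<close>. As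
  \<open>B\<close> reaches \<open>c1\<close>, it lies in one of the two halves; as it also reaches
  \<open>c2\<close>, this is the half enclosed by \<open>c1\<close> and \<open>c2\<close>.\<close>

lemma inside_if_arc_inside:
  assumes B: "connected B" "B \<inter> (path_image c1 \<union> path_image c2 \<union> path_image c3) = {}"
    and q: "q \<in> path_image c1 - {p, r}" "q \<in> closure B"
    and s: "s \<in> path_image c2 - {p, r}" "s \<in> closure B"
    and c1: "path_image c1 \<inter> inside (path_image c2 \<union> path_image c3) \<noteq> {}"
    and w: "w \<in> B"
  shows "w \<in> inside (path_image c1 \<union> path_image c2)"
proof (rule ccontr)
  let ?A = "path_image c1" and ?B = "path_image c2" and ?C = "path_image c3"
  interpret J31: theta_curve c3 c1 c2 p r by (rule permute)
  interpret J23: theta_curve c2 c3 c1 p r by (rule permute)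
  assume nw: "w \<notin> inside (?A \<union> ?B)"
  obtain q' where q': "q' \<in> ?A" "q' \<in> inside (?B \<union> ?C)" using c1 by auto
  moreover have "q' \<notin> {p, r}" using q' inters inside_no_overlap[of "?B \<union> ?C"] by blast
  ultimately have "q \<in> inside (?B \<union> ?C)"
    using connected_inside_iff[OF endless(1), of "?B \<union> ?C" q' q] q(1) inters by blast
  then obtain b where b: "b \<in> B" "b \<in> inside (?B \<union> ?C)"
    using q(2) J23.Jordan(2) by (meson closure_iff_nhds_not_empty disjoint_iff subset_refl)
  have "B \<subseteq> inside (?B \<union> ?C)"
    using connected_inside_iff[OF B(1), of "?B \<union> ?C" b] b B(2) by blast
  then have "w \<in> inside (?C \<union> ?A)"
    using J23.split_inside[OF c1] w nw B(2) by (auto simp: Un_commute)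
  then have "B \<subseteq> inside (?C \<union> ?A)"
    using connected_inside_iff[OF B(1), of "?C \<union> ?A" w] w B(2) by blast
  then have "s \<in> ?C \<union> ?A \<union> inside (?C \<union> ?A)"
    using s(2) J31.closure_inside closure_mono by blast
  then have "s \<in> inside (?B \<union> ?C)" using s(1) inters J23.split_inside[OF c1] by auto
  then show False using s(1) inside_no_overlap[of "?B \<union> ?C"] by blast
qed

text \<open>Inside and outside need different arguments. If \<open>c3\<close> runs inside, it
  separates the ends of \<open>b\<close> there. If it does not, then one of \<open>c1\<close>,
  \<open>c2\<close> runs inside the curve formed by the other two arcs, and this forces
  \<open>b\<close> inside.\<close>

lemma chords_on_opposite_sides:
  assumes b: "arc b" "pathstart b = q" "pathfinish b = s"
    and q: "q \<noteq> p" "q \<noteq> r" "path_image b \<inter> path_image c1 = {q}"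
    and s: "s \<noteq> p" "s \<noteq> r" "path_image b \<inter> path_image c2 = {s}"
    and c3: "path_image b \<inter> path_image c3 = {}"
    and z: "z \<in> path_image c3 - {p, r}" and w: "w \<in> path_image b - {q, s}"
  shows "z \<in> inside (path_image c1 \<union> path_image c2) \<longleftrightarrow> w \<notin> inside (path_image c1 \<union> path_image c2)"
proof -
  let ?A = "path_image c1" and ?B = "path_image c2" and ?C = "path_image c3"
  define B where "B = path_image b - {q, s}"
  interpret J21: theta_curve c2 c1 c3 p r by (rule permute)
  interpret J31: theta_curve c3 c1 c2 p r by (rule permute)
  have conB: "connected B"
    using connected_simple_path_endless[of b] b unfolding B_def by (simp add: arc_imp_simple_path)
  have disj: "B \<inter> (?A \<union> ?B \<union> ?C) = {}" using q s c3 unfolding B_def by blast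
  have "path_image b \<subseteq> closure B"
    using path_image_subset_closure_endless[OF b(1)] b unfolding B_def by simp
  then have cl: "q \<in> closure B" "s \<in> closure B"
    using b pathstart_in_path_image[of b] pathfinish_in_path_image[of b] by auto
  have wB: "w \<in> B" using w B_def by simp
  have qs: "q \<in> ?A - {p, r}" "s \<in> ?B - {p, r}" using q s by blast+
  show ?thesis
  proof (cases "z \<in> inside (?A \<union> ?B)")
    case True
    then show ?thesis
      using no_common_inside_chord[OF conB disj qs(1) cl(1) qs(2) cl(2) _ wB] z by blast
  next
    case False
    have "?C \<inter> inside (?A \<union> ?B) = {}"
    proof (rule ccontr)
      assume "?C \<inter> inside (?A \<union> ?B) \<noteq> {}"
      then obtain z' where z': "z' \<in> ?C" "z' \<in> inside (?A \<union> ?B)" by blast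
      then have "z' \<in> ?C - {p, r}" using inters inside_no_overlap[of "?A \<union> ?B"] by blast
      then show False
        using connected_inside_iff[OF J31.endless(1), of "?A \<union> ?B" z z'] z z' False inters by blast
    qed
    then consider "?A \<inter> inside (?B \<union> ?C) \<noteq> {}" | "?B \<inter> inside (?A \<union> ?C) \<noteq> {}"
      using some_arc_inside by blast
    then have "w \<in> inside (?A \<union> ?B)"
    proof cases
      case 1
      then show ?thesis using inside_if_arc_inside[OF conB disj qs(1) cl(1) qs(2) cl(2) _ wB] by blast
    next
      case 2
      have "B \<inter> (?B \<union> ?A \<union> ?C) = {}" using disj by blast
      then show ?thesis
        using J21.inside_if_arc_inside[OF conB _ qs(2) cl(2) qs(1) cl(1) 2 wB] by (simp add: Un_commute)
    qed
    then show ?thesis using False by blast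
  qed
qed

end

subsection \<open>Paths and cycles as lists\<close>

fun path_edges :: "'a list \<Rightarrow> 'a set set" where
  "path_edges (x # y # xs) = insert {x, y} (path_edges (y # xs))"
| "path_edges _ = {}"

lemma path_edges_Cons: "path_edges (x # xs) = (if xs = [] then {} else insert {x, hd xs} (path_edges xs))"
  by (cases xs) auto

lemma path_edges_append:
  "path_edges (xs @ ys) =
     path_edges xs \<union> path_edges ys \<union> (if xs = [] \<or> ys = [] then {} else {{last xs, hd ys}})"
  by (induction xs) (auto simp: path_edges_Cons)

lemma path_edges_rev: "path_edges (rev xs) = path_edges xs"
  by (induction xs) (auto simp: path_edges_Cons path_edges_append last_rev insert_commute)

lemma path_edges_conv_nth: "path_edges xs = {{xs ! i, xs ! Suc i} | i. Suc i < length xs}"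
proof (induction xs rule: path_edges.induct)
  case (1 x y xs)
  have "{{(x # y # xs) ! i, (x # y # xs) ! Suc i} | i. Suc i < length (x # y # xs)} =
    insert {x, y} {{(y # xs) ! i, (y # xs) ! Suc i} | i. Suc i < length (y # xs)}"
    (is "?L = ?R")
  proof (intro set_eqI iffI)
    fix e assume "e \<in> ?L"
    then obtain i where "e = {(x # y # xs) ! i, (x # y # xs) ! Suc i}" "Suc i < length (x # y # xs)" by blast
    then show "e \<in> ?R" by (cases i) auto
  next
    fix e assume "e \<in> ?R"
    then consider "e = {x, y}" | i where "e = {(y # xs) ! i, (y # xs) ! Suc i}" "Suc i < length (y # xs)" by blast
    then show "e \<in> ?L"
    proof cases
      case 1 then show ?thesis by (intro CollectI exI[of _ 0]) auto
    next
      case 2 then show ?thesis by (intro CollectI exI[of _ "Suc i"]) auto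
    qed
  qed
  then show ?case using 1 by simp
qed auto

lemma successively_conv_nth: "successively P xs \<longleftrightarrow> (\<forall>i. Suc i < length xs \<longrightarrow> P (xs ! i) (xs ! Suc i))"
proof (induction xs rule: path_edges.induct)
  case (1 x y xs)
  have "(\<forall>i. Suc i < length (x # y # xs) \<longrightarrow> P ((x # y # xs) ! i) ((x # y # xs) ! Suc i)) \<longleftrightarrow>
    P x y \<and> (\<forall>i. Suc i < length (y # xs) \<longrightarrow> P ((y # xs) ! i) ((y # xs) ! Suc i))"
    (is "?L \<longleftrightarrow> ?R")
  proof (intro iffI conjI allI impI)
    assume ?L
    then show "P x y" by force
    show "P ((y # xs) ! i) ((y # xs) ! Suc i)" if "Suc i < length (y # xs)" for i
      using \<open>?L\<close>[rule_format, of "Suc i"] that by simp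
  next
    fix i assume "?R" "Suc i < length (x # y # xs)"
    then show "P ((x # y # xs) ! i) ((x # y # xs) ! Suc i)" by (cases i) auto
  qed
  then show ?case using 1 by simp
qed auto

lemma successively_rev_sym:
  assumes "\<And>u v. E u v \<Longrightarrow> E v u" "successively E xs"
  shows "successively E (rev xs)"
  unfolding successively_rev by (rule successively_mono[OF assms(2)]) (use assms(1) in auto)

lemma path_edge_subset: "e \<in> path_edges xs \<Longrightarrow> e \<subseteq> set xs"
  by (induction xs rule: path_edges.induct) auto

lemma path_edge_obtain:
  assumes "e \<in> path_edges xs" "successively E xs"
  obtains u v where "e = {u, v}" "E u v" "u \<in> set xs" "v \<in> set xs"
  using assms by (induction xs rule: path_edges.induct) auto

lemma ends_not_path_edge:
  assumes "distinct (p # A @ [r])" "A \<noteq> []"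
  shows "{p, r} \<notin> path_edges (p # A @ [r])"
  using assms path_edge_subset[of "{p, r}" A]
  by (auto simp: path_edges_Cons path_edges_append doubleton_eq_iff)

lemma nth_append_hd:
  assumes "i < length c"
  shows "(c @ [hd c]) ! i = c ! i" "(c @ [hd c]) ! Suc i = c ! ((i + 1) mod length c)"
proof -
  show "(c @ [hd c]) ! i = c ! i" using assms by (simp add: nth_append)
  have "c \<noteq> []" using assms by auto
  show "(c @ [hd c]) ! Suc i = c ! ((i + 1) mod length c)"
    using assms hd_conv_nth[OF \<open>c \<noteq> []\<close>] by (cases "Suc i = length c") (auto simp: nth_append)
qed

text \<open>Repeating the head at the end replaces indices modulo the length by list recursion, so
  that cycles can be cut and rejoined with the append laws.\<close>

lemma cycle_edges_conv: "cycle_edges c = path_edges (c @ [hd c])"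
  unfolding cycle_edges_def path_edges_conv_nth using nth_append_hd[of _ c]
  by (intro Collect_cong ex_cong1) auto

lemma is_cycle_conv: "is_cycle E c \<longleftrightarrow> length c \<ge> 3 \<and> distinct c \<and> successively E (c @ [hd c])"
  unfolding is_cycle_def successively_conv_nth using nth_append_hd[of _ c] by auto

lemma cycle_edge_subset:
  assumes "is_cycle E c" "e \<in> cycle_edges c"
  shows "e \<subseteq> set c"
proof -
  have "hd c \<in> set c" using assms(1) by (cases c) (auto simp: is_cycle_def)
  then show ?thesis using path_edge_subset[of e "c @ [hd c]"] assms(2) by (auto simp: cycle_edges_conv)
qed

lemma cycle_edges_append_commute: "cycle_edges (xs @ ys) = cycle_edges (ys @ xs)"
  by (cases "xs = []"; cases "ys = []") (auto simp: cycle_edges_conv path_edges_append)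

lemma is_cycle_append_commute: "is_cycle E (xs @ ys) \<Longrightarrow> is_cycle E (ys @ xs)"
  by (cases "xs = []"; cases "ys = []") (auto simp: is_cycle_conv successively_append_iff)

section \<open>Rotating and cutting cycles, and cycles that share an edge\<close>

lemma cycle_rotate:
  assumes "is_cycle E c" "x \<in> set c"
  obtains ys where "is_cycle E (x # ys)" "cycle_edges (x # ys) = cycle_edges c" "set (x # ys) = set c"
proof -
  obtain as bs where c: "c = as @ x # bs" using assms(2) by (meson split_list)
  show thesis
    using is_cycle_append_commute[of E as "x # bs"] cycle_edges_append_commute[of as "x # bs"] assms(1)
    by (intro that[of "bs @ as"]) (auto simp: c)
qed

lemma cycle_split:
  assumes "is_cycle E c" "x \<in> set c" "y \<in> set c" "x \<noteq> y"
  obtains X Y where "is_cycle E (x # X @ y # Y)" "cycle_edges (x # X @ y # Y) = cycle_edges c"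
    "set (x # X @ y # Y) = set c"
proof -
  obtain ys where ys: "is_cycle E (x # ys)" "cycle_edges (x # ys) = cycle_edges c" "set (x # ys) = set c"
    using cycle_rotate[OF assms(1,2)] by metis
  then obtain X Y where "ys = X @ y # Y" using assms by (metis set_ConsD split_list)
  then show thesis using that ys by metis
qed

text \<open>Let \<open>c'\<close> leave \<open>c\<close> at \<open>x\<close> right after a common
  edge and follow it to its first return at \<open>y\<close>. This segment and the two arcs of
  \<open>c\<close> between \<open>x\<close> and \<open>y\<close> are the three paths. At most one of
  them is a single edge, because the segment starts with an edge off \<open>c\<close> and
  \<open>c\<close> has at least three vertices.\<close>

lemma not_cactus_imp_theta:
  assumes sym: "\<And>u v. E u v \<Longrightarrow> E v u" and "\<not> cactus V E"
  obtains x y A1 A2 A3 where "distinct (x # y # A1 @ A2 @ A3)"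
    "successively E (x # A1 @ [y])" "successively E (x # A2 @ [y])" "successively E (x # A3 @ [y])"
    "A1 \<noteq> []" "A2 \<noteq> []"
proof -
  \<comment> \<open>All edges of one cycle might lie on the other one; the roles are then exchanged
    so that \<open>c'\<close> has an edge off \<open>c\<close>.\<close>
  obtain c c' where c: "is_cycle E c" and c': "is_cycle E c'"
    and meet: "cycle_edges c \<inter> cycle_edges c' \<noteq> {}" and new: "\<not> cycle_edges c' \<subseteq> cycle_edges c"
  proof -
    obtain c1 c2 where c12: "is_cycle E c1" "is_cycle E c2" "cycle_edges c1 \<inter> cycle_edges c2 \<noteq> {}"
      "cycle_edges c1 \<noteq> cycle_edges c2"
      using assms(2) unfolding cactus_def by blast
    show thesis
    proof (cases "cycle_edges c2 \<subseteq> cycle_edges c1")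
      case True
      then show ?thesis using that[of c2 c1] c12 by auto
    next
      case False
      then show ?thesis using that[of c1 c2] c12 by auto
    qed
  qed
  define n where "n = length c'"
  have n: "n \<ge> 3" using c' unfolding is_cycle_def n_def by auto
  define P where "P i \<longleftrightarrow> {c' ! (i mod n), c' ! (Suc i mod n)} \<in> cycle_edges c" for i
  have c'_edges: "cycle_edges c' = {{c' ! (i mod n), c' ! (Suc i mod n)} | i. i < n}"
    unfolding cycle_edges_def n_def by (intro Collect_cong ex_cong1) auto
  have "\<exists>i<n. P i" "\<exists>i<n. \<not> P i" using meet new unfolding P_def c'_edges by auto
  then obtain i0 i1 where "P i0" "i0 < n" "\<not> P i1" "i1 < n" by blast
  \<comment> \<open>\<open>P\<close> is periodic, so a false index can be moved beyond the true
    index \<open>i0\<close>, and somewhere in between \<open>P\<close> changes from true to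
    false.\<close>
  moreover have "P (i + n) = P i" for i
    unfolding P_def using n by (simp add: mod_Suc)
  ultimately have "P i0" "\<not> P (i1 + n)" "i0 < i1 + n" by auto
  then obtain i where i: "P i" "\<not> P (Suc i)"
    using dec_induct[of i0 "i1 + n" P] by (metis less_imp_le_nat)
  \<comment> \<open>\<open>w\<close> is \<open>c'\<close> rotated to start where it leaves
    \<open>c\<close>: its first edge is off \<open>c\<close>, while the edge from its last vertex
    back to the first is on \<open>c\<close>.\<close>
  define k where "k = Suc i mod n"
  have k: "k < n" using n unfolding k_def by simp
  define w where "w = drop k c' @ take k c'"
  have w: "is_cycle E w" "length w = n"
    using is_cycle_append_commute[of E "take k c'" "drop k c'"] c' unfolding w_def n_def by auto
  have w_nth: "w ! j = c' ! ((j + k) mod n)" if "j < n" for j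
    using rotate_drop_take[of k c'] k nth_rotate[of j c' k] that unfolding w_def n_def by (simp add: add.commute)
  have w0: "w ! 0 = c' ! (Suc i mod n)" and w1: "w ! 1 = c' ! (Suc (Suc i) mod n)"
    and wl: "w ! (n - 1) = c' ! (i mod n)"
  proof -
    show "w ! 0 = c' ! (Suc i mod n)" "w ! 1 = c' ! (Suc (Suc i) mod n)"
      using w_nth[of 0] w_nth[of 1] n unfolding k_def by (auto simp: mod_Suc_eq)
    have "(n - 1 + Suc i mod n) mod n = (n - 1 + Suc i) mod n" by (simp add: mod_add_right_eq)
    also have "n - 1 + Suc i = i + n" using n by simp
    finally show "w ! (n - 1) = c' ! (i mod n)" using w_nth[of "n - 1"] n unfolding k_def by simp
  qed
  have edge_in: "u \<in> set c" if "{u, v} \<in> cycle_edges c" for u v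
    using cycle_edge_subset[OF c that] by simp
  define x where "x = w ! 0"
  obtain ws where ws: "w = x # ws" using w n unfolding x_def by (cases w) auto
  have x: "x \<in> set c" using i(1) edge_in w0 unfolding P_def x_def by (metis insert_commute)
  have "w ! (n - 1) \<in> set c" using i(1) edge_in wl unfolding P_def by metis
  \<comment> \<open>The last vertex of \<open>w\<close> is on \<open>c\<close>, so the first return
    happens there at the latest, and hence at a vertex other than \<open>x\<close>.\<close>
  moreover have "w ! (n - 1) \<in> set ws"
  proof -
    have "w ! (n - 1) = ws ! (n - 2)" using n by (simp add: ws nth_Cons' numeral_2_eq_2)
    then show ?thesis using w(2) n by (simp add: ws)
  qed
  ultimately obtain A3 y R where A3: "ws = A3 @ y # R" "y \<in> set c" "\<forall>a\<in>set A3. a \<notin> set c"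
    using split_list_first_prop[of ws "\<lambda>a. a \<in> set c"] by metis
  have dw: "distinct (x # A3 @ y # R)" "successively E ((x # A3 @ [y]) @ R @ [x])"
    using w(1) unfolding is_cycle_conv ws A3(1) by auto
  obtain X Y where XY: "is_cycle E (x # X @ y # Y)" "cycle_edges (x # X @ y # Y) = cycle_edges c"
    "set (x # X @ y # Y) = set c"
    using cycle_split[OF c x A3(2)] dw by auto
  have E1: "successively E (x # X @ [y])" and E2: "successively E (x # rev Y @ [y])"
    and E3: "successively E (x # A3 @ [y])"
  proof -
    have s: "successively E ((x # X @ [y]) @ (Y @ [x]))" using XY(1) unfolding is_cycle_conv by simp
    then show "successively E (x # X @ [y])" using successively_append_iff by blast
    have "successively E (y # Y @ [x])" using s by (auto simp: successively_append_iff successively_Cons)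
    then have "successively E (rev (y # Y @ [x]))" using successively_rev_sym[of E] sym by blast
    then show "successively E (x # rev Y @ [y])" by simp
    show "successively E (x # A3 @ [y])" using dw(2) successively_append_iff by blast
  qed
  have new_edge: "{x, y} \<notin> cycle_edges (x # X @ y # Y)" if "A3 = []"
    using i(2) that w0 w1 XY(2) unfolding P_def x_def by (simp add: ws A3(1))
  have ne: "A3 \<noteq> [] \<or> X \<noteq> []" "A3 \<noteq> [] \<or> Y \<noteq> []" "X \<noteq> [] \<or> Y \<noteq> []"
    using new_edge XY(1) by (auto simp: cycle_edges_conv path_edges_append path_edges_Cons is_cycle_conv)
  have d: "distinct (x # y # X @ Y @ A3)"
    using XY(1,3) A3(3) dw(1) unfolding is_cycle_conv by auto
  consider "X \<noteq> []" "Y \<noteq> []" | "X \<noteq> []" "A3 \<noteq> []" | "Y \<noteq> []" "A3 \<noteq> []" using ne by blast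
  then show thesis
  proof cases
    case 1 then show ?thesis using that[of x y X "rev Y" A3] d E1 E2 E3 by auto
  next
    case 2 then show ?thesis using that[of x y X A3 "rev Y"] d E1 E2 E3 by auto
  next
    case 3 then show ?thesis using that[of x y "rev Y" A3 X] d E1 E2 E3 by auto
  qed
qed

text \<open>The path and one arc of \<open>c\<close> between its ends form a second cycle. It shares
  the edges of that arc with \<open>c\<close>, yet its edge that enters \<open>q\<close> from the
  path is not on \<open>c\<close>.\<close>

lemma cactus_no_chord_path:
  assumes sym: "\<And>u v. E u v \<Longrightarrow> E v u" and "cactus V E" and c: "is_cycle E c"
    and ends: "p \<in> set c" "q \<in> set c" and dist: "distinct (p # A @ [q])"
    and path: "successively E (p # A @ [q])" and disj: "set A \<inter> set c = {}"
    and new: "A \<noteq> [] \<or> {p, q} \<notin> cycle_edges c"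
  shows False
proof -
  have "p \<noteq> q" using dist by auto
  then obtain X Y where XY: "is_cycle E (p # X @ q # Y)" "cycle_edges (p # X @ q # Y) = cycle_edges c"
    "set (p # X @ q # Y) = set c"
    using cycle_split[OF c ends] by metis
  define c' where "c' = p # X @ q # rev A"
  have "X @ A \<noteq> []"
    using new XY(2)[symmetric] by (auto simp: cycle_edges_conv path_edges_append path_edges_Cons)
  then have len: "length c' \<ge> 3" unfolding c'_def by (cases X; cases A) auto
  have "successively E (p # X @ [q])"
    using XY(1) successively_append_iff[of E "p # X @ [q]" "Y @ [p]"] unfolding is_cycle_conv by simp
  moreover have "successively E (q # rev A @ [p])"
  proof -
    have "successively E (rev (p # A @ [q]))" using successively_rev_sym[of E] sym path by blast
    then show ?thesis by simp
  qed
  ultimately have "successively E (c' @ [hd c'])"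
    using successively_append_iff[of E "p # X @ [q]" "rev A @ [p]"] unfolding c'_def
    by (auto simp: successively_Cons)
  moreover have "distinct c'" using XY(1,3) dist disj unfolding c'_def is_cycle_conv by auto
  ultimately have c': "is_cycle E c'" using len unfolding is_cycle_conv by simp
  have "{p, hd (X @ [q])} \<in> cycle_edges c' \<inter> cycle_edges c"
    unfolding XY(2)[symmetric] c'_def by (cases X) (auto simp: cycle_edges_conv path_edges_Cons)
  then have same: "cycle_edges c' = cycle_edges c"
    using assms(2) c c' unfolding cactus_def by blast
  have e: "{q, hd (rev A @ [p])} \<in> cycle_edges c'"
    unfolding c'_def by (cases "rev A = []") (auto simp: cycle_edges_conv path_edges_append path_edges_Cons)
  show False
  proof (cases "A = []")
    case True
    then show ?thesis using e same new by (simp add: insert_commute)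
  next
    case False
    then have h: "hd (rev A @ [p]) \<in> set A" by (simp add: hd_append hd_rev)
    have "{q, hd (rev A @ [p])} \<subseteq> set c" using e same cycle_edge_subset[OF c] by metis
    then show ?thesis using h disj by auto
  qed
qed

section \<open>Parity of cycles and bipartiteness\<close>

lemma alternating_cycle_even:
  fixes s :: "nat \<Rightarrow> bool"
  assumes "n > 0" and alt: "\<And>i. i < n \<Longrightarrow> s ((i + 1) mod n) = (\<not> s i)"
  shows "even n"
proof -
  have "s i = (s 0 = even i)" if "i < n" for i
    using that
  proof (induction i)
    case (Suc i)
    then show ?case using alt[of i] by auto
  qed auto
  from this[of "n - 1"] alt[of "n - 1"] assms(1) show ?thesis by (cases n) auto
qed

lemma bipartite_cycle_even:
  fixes V :: "'a set"
  assumes "bipartite V E" "is_cycle E c"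
  shows "even (length c)"
proof -
  obtain col :: "'a \<Rightarrow> bool" where col: "\<And>u v. E u v \<Longrightarrow> col u \<noteq> col v" using assms(1) unfolding bipartite_def by blast
  show ?thesis
    using assms(2) col by (intro alternating_cycle_even[where s = "\<lambda>i. col (c ! i)"]) (force simp: is_cycle_def)+
qed

text \<open>Colour a vertex by whether some even walk from a root reaches it. An edge with equally
  coloured ends closes an odd walk, and a shortest closed odd walk is a cycle: a repeated vertex
  would cut it into two shorter closed walks, one of them odd.\<close>

lemma not_bipartite_imp_odd_cycle:
  assumes "simple_graph V E" "connected_graph V E" "\<not> bipartite V E"
  obtains c where "is_cycle E c" "odd (length c)"
proof -
  define R where "R = {(x, y). E x y}"
  have symR: "(y, x) \<in> R" if "(x, y) \<in> R" for x y
    using that assms(1) unfolding R_def simple_graph_def by auto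
  have sym: "(y, x) \<in> R ^^ n" if "(x, y) \<in> R ^^ n" for x y n
    using that
  proof (induction n arbitrary: y)
    case (Suc n)
    obtain z where "(x, z) \<in> R ^^ n" "(z, y) \<in> R" using Suc.prems by (rule relpow_Suc_E)
    then show ?case using Suc.IH symR relpow_Suc_I2 by metis
  qed auto
  obtain r where r: "r \<in> V" using assms(2) unfolding connected_graph_def by auto
  have reach: "\<exists>n. (r, v) \<in> R ^^ n" if "v \<in> V" for v
    using assms(2) r that unfolding connected_graph_def R_def by (meson rtrancl_imp_relpow)
  define col where "col v \<longleftrightarrow> (\<exists>n. even n \<and> (r, v) \<in> R ^^ n)" for v
  obtain u v where uv: "E u v" "col u = col v" using assms(3) unfolding bipartite_def by blast
  then have V: "u \<in> V" "v \<in> V" using assms(1) unfolding simple_graph_def by auto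
  have "\<exists>m n. even (m + n) \<and> (r, u) \<in> R ^^ m \<and> (r, v) \<in> R ^^ n"
    using uv(2) reach[OF V(1)] reach[OF V(2)] unfolding col_def by (metis even_add)
  then obtain m n where mn: "even (m + n)" "(r, u) \<in> R ^^ m" "(v, r) \<in> R ^^ n" using sym by blast
  then have "(r, r) \<in> R ^^ (m + (1 + n))"
    using uv(1) unfolding relpow_add R_def by auto
  then have ex: "\<exists>n. odd n \<and> (\<exists>r. (r, r) \<in> R ^^ n)" using mn(1)
    by (intro exI[of _ "m + (1 + n)"]) auto
  \<comment> \<open>The minimum is taken over all base points, since a piece cut off at a repeated
    vertex is based at that vertex.\<close>
  define N where "N = (LEAST n. odd n \<and> (\<exists>r. (r, r) \<in> R ^^ n))"
  have N: "odd N" "\<exists>r. (r, r) \<in> R ^^ N" and least: "\<And>k a. k < N \<Longrightarrow> odd k \<Longrightarrow> (a, a) \<notin> R ^^ k"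
    using LeastI_ex[OF ex] not_less_Least unfolding N_def by blast+
  obtain t h where h: "h 0 = t" "h N = t" "\<forall>i<N. (h i, h (Suc i)) \<in> R"
    using N(2) unfolding relpow_fun_conv by blast
  have seg: "(h i, h (i + k)) \<in> R ^^ k" if "i + k \<le> N" for i k
    unfolding relpow_fun_conv using h(3) that by (intro exI[of _ "\<lambda>j. h (i + j)"]) auto
  have inj: "h i \<noteq> h j" if "i < j" "j < N" for i j
  proof
    assume eq: "h i = h j"
    have "(h i, h i) \<in> R ^^ (j - i)" using seg[of i "j - i"] that eq by simp
    moreover have "(t, h i) \<in> R ^^ i" "(h i, t) \<in> R ^^ (N - j)"
      using seg[of 0 i] seg[of j "N - j"] that eq h by auto
    then have "(t, t) \<in> R ^^ (i + (N - j))" unfolding relpow_add by blast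
    moreover have "odd (j - i) \<or> odd (i + (N - j))" using N(1) that by presburger
    moreover have "j - i < N" "i + (N - j) < N" using that by auto
    ultimately show False using least by blast
  qed
  have "N \<noteq> 1"
    using h assms(1) unfolding R_def simple_graph_def by auto
  then have N3: "N \<ge> 3" using N(1) by presburger
  have "is_cycle E (map h [0..<N])"
    unfolding is_cycle_def
  proof (intro conjI allI impI)
    show "distinct (map h [0..<N])"
      using inj by (auto simp: distinct_map inj_on_def) (metis linorder_neqE_nat)
    fix i assume "i < length (map h [0..<N])"
    then show "E (map h [0..<N] ! i) (map h [0..<N] ! ((i + 1) mod length (map h [0..<N])))"
      using h N3 unfolding R_def by (cases "Suc i = N") auto
  qed (use N3 in auto)
  then show thesis using that[of "map h [0..<N]"] N(1) by auto
qed

subsection \<open>Crossing paths in a plane drawing\<close>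

locale plane_drawing =
  fixes V :: "'v set" and E :: "'v \<Rightarrow> 'v \<Rightarrow> bool"
    and f :: "'v \<Rightarrow> complex" and g :: "'v \<Rightarrow> 'v \<Rightarrow> real \<Rightarrow> complex"
  assumes inj: "inj_on f V"
    and edge_verts: "E u v \<Longrightarrow> u \<in> V \<and> v \<in> V \<and> u \<noteq> v"
    and edge_sym: "E u v \<Longrightarrow> E v u"
    and edge_arc: "E u v \<Longrightarrow> arc (g u v) \<and> pathstart (g u v) = f u \<and> pathfinish (g u v) = f v"
    and image_sym: "E u v \<Longrightarrow> path_image (g v u) = path_image (g u v)"
    and vertex_on_edge: "E u v \<Longrightarrow> w \<in> V \<Longrightarrow> f w \<in> path_image (g u v) \<Longrightarrow> w = u \<or> w = v"
    and edges_meet: "E u v \<Longrightarrow> E x y \<Longrightarrow> {u, v} \<noteq> {x, y} \<Longrightarrow>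
        path_image (g u v) \<inter> path_image (g x y) \<subseteq> f ` ({u, v} \<inter> {x, y})"
begin

text \<open>Indexed by sets of edges rather than by lists, so that a cycle has the same trace
  however it is cut into two paths.\<close>

definition edges_image :: "'v set set \<Rightarrow> complex set" where
  "edges_image F = \<Union>{path_image (g u v) | u v. {u, v} \<in> F \<and> E u v}"

abbreviation path_trace :: "'v list \<Rightarrow> complex set" where
  "path_trace xs \<equiv> edges_image (path_edges xs)"

lemma edges_image_Un: "edges_image (F \<union> G) = edges_image F \<union> edges_image G"
  unfolding edges_image_def by blast

lemma edges_image_empty [simp]: "edges_image {} = {}"
  unfolding edges_image_def by simp

lemma edges_image_single: "E u v \<Longrightarrow> edges_image {{u, v}} = path_image (g u v)"
  using edge_sym image_sym unfolding edges_image_def by (fastforce simp: doubleton_eq_iff)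

lemma edges_image_insert: "E u v \<Longrightarrow> edges_image (insert {u, v} F) = path_image (g u v) \<union> edges_image F"
  using edges_image_Un[of "{{u, v}}" F] edges_image_single[of u v] by simp

lemma edges_image_Int:
  assumes "F \<inter> G = {}" "\<Union>F \<inter> \<Union>G \<subseteq> S"
  shows "edges_image F \<inter> edges_image G \<subseteq> f ` S"
proof
  fix z assume "z \<in> edges_image F \<inter> edges_image G"
  then obtain u v x y where e: "{u, v} \<in> F" "E u v" "z \<in> path_image (g u v)"
    "{x, y} \<in> G" "E x y" "z \<in> path_image (g x y)"
    unfolding edges_image_def by blast
  then have "{u, v} \<noteq> {x, y}" using assms(1) by auto
  then have "z \<in> f ` ({u, v} \<inter> {x, y})" using edges_meet[of u v x y] e by auto
  then show "z \<in> f ` S" using e(1,4) assms(2) by blast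
qed

lemma vertex_in_trace:
  assumes "successively E xs" "w \<in> V" "f w \<in> path_trace xs"
  shows "w \<in> set xs"
  using assms
proof (induction xs rule: path_edges.induct)
  case (1 x y xs)
  then show ?case using vertex_on_edge[of x y w] by (auto simp: edges_image_insert)
qed auto

lemma vertex_in_trace_iff:
  assumes "successively E xs" "w \<in> V" "length xs \<ge> 2"
  shows "f w \<in> path_trace xs \<longleftrightarrow> w \<in> set xs"
proof
  show "w \<in> set xs \<Longrightarrow> f w \<in> path_trace xs"
    using assms(1,3)
  proof (induction xs rule: path_edges.induct)
    case (1 x y xs)
    have "f x \<in> path_image (g x y)" "f y \<in> path_image (g x y)"
      using 1(3) edge_arc[of x y] pathstart_in_path_image[of "g x y"] pathfinish_in_path_image[of "g x y"] by auto
    then show ?case using 1 by (cases xs) (auto simp: edges_image_insert)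
  qed auto
qed (use vertex_in_trace assms in auto)

lemma trace_arc:
  assumes "successively E xs" "distinct xs" "length xs \<ge> 2"
  obtains c where "arc c" "pathstart c = f (hd xs)" "pathfinish c = f (last xs)"
    "path_image c = path_trace xs"
proof -
  have "\<exists>c. arc c \<and> pathstart c = f (hd xs) \<and> pathfinish c = f (last xs) \<and> path_image c = path_trace xs"
    using assms
  proof (induction xs rule: path_edges.induct)
    case (1 x y xs)
    then have xy: "E x y" by simp
    show ?case
    proof (cases "xs = []")
      case True
      then show ?thesis using edge_arc[OF xy] edges_image_single[OF xy] by auto
    next
      case False
      then have "length (y # xs) \<ge> 2" by (cases xs) auto
      then obtain c where c: "arc c" "pathstart c = f y" "pathfinish c = f (last xs)"
        "path_image c = path_trace (y # xs)"
        using 1 False by auto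
      have "{x, y} \<notin> path_edges (y # xs)" using 1(3) path_edge_subset by fastforce
      then have "edges_image {{x, y}} \<inter> path_trace (y # xs) \<subseteq> f ` {y}"
        using path_edge_subset[of _ "y # xs"] 1(3) by (intro edges_image_Int) auto
      then have "path_image (g x y) \<inter> path_image c \<subseteq> {pathstart c}"
        using edges_image_single[OF xy] c by simp
      then have "arc (g x y +++ c)" using edge_arc[OF xy] c by (intro arc_join) auto
      then show ?thesis
        using edge_arc[OF xy] c False
        by (intro exI[of _ "g x y +++ c"]) (auto simp: path_image_join edges_image_insert[OF xy])
    qed
  qed auto
  then show thesis using that by blast
qed

text \<open>The graph form of the side test: the first two paths form the cycle through
  \<open>p\<close>, \<open>q\<close>, \<open>r\<close>, \<open>s\<close>, the path over
  \<open>U\<close> completes the theta curve and the path over \<open>T\<close> is the crossing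
  chord. \<open>F\<close> is a separate parameter so that one cycle can be cut at different vertices
  while the curve in the side test stays the same.\<close>

lemma crossing_paths:
  assumes P1: "successively E (p # X @ q # Y @ [r])"
    and P2: "successively E (p # Z @ s # W @ [r])"
    and Q: "successively E (p # U @ [r])"
    and R: "successively E (q # T @ [s])"
    and dist: "distinct (p # q # r # s # X @ Y @ Z @ W @ U @ T)"
    and F: "F = path_edges (p # X @ q # Y @ [r]) \<union> path_edges (p # Z @ s # W @ [r])"
    and z: "z \<in> path_trace (p # U @ [r])" "z \<noteq> f p" "z \<noteq> f r"
    and w: "w \<in> path_trace (q # T @ [s])" "w \<noteq> f q" "w \<noteq> f s"
  shows "z \<in> inside (edges_image F) \<longleftrightarrow> w \<notin> inside (edges_image F)"
proof -
  let ?P1 = "p # X @ q # Y @ [r]" and ?P2 = "p # Z @ s # W @ [r]"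
  let ?Q = "p # U @ [r]" and ?R = "q # T @ [s]"
  have d: "distinct ?P1" "distinct ?P2" "distinct ?Q" "distinct ?R" using dist by auto
  obtain c1 where c1: "arc c1" "pathstart c1 = f p" "pathfinish c1 = f r" "path_image c1 = path_trace ?P1"
    using trace_arc[OF P1 d(1)] by auto
  obtain c2 where c2: "arc c2" "pathstart c2 = f p" "pathfinish c2 = f r" "path_image c2 = path_trace ?P2"
    using trace_arc[OF P2 d(2)] by auto
  obtain c3 where c3: "arc c3" "pathstart c3 = f p" "pathfinish c3 = f r" "path_image c3 = path_trace ?Q"
    using trace_arc[OF Q d(3)] by auto
  obtain b where b: "arc b" "pathstart b = f q" "pathfinish b = f s" "path_image b = path_trace ?R"
    using trace_arc[OF R d(4)] by auto
  have walk_verts: "set xs \<subseteq> V" if "successively E xs" "length xs \<ge> 2" for xs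
    using that
  proof (induction xs rule: path_edges.induct)
    case (1 x y xs)
    then show ?case using edge_verts[of x y] by (cases xs) auto
  qed auto
  have inV: "set ?P1 \<subseteq> V" "set ?P2 \<subseteq> V"
    by (rule walk_verts[OF P1], simp) (rule walk_verts[OF P2], simp)
  \<comment> \<open>A common edge has both ends in \<open>S\<close> and thus equals
    \<open>S\<close>, as \<open>card S \<le> 2\<close>; excluding this one edge is enough.\<close>
  have share: "path_trace xs \<inter> path_trace ys \<subseteq> f ` S"
    if "set xs \<inter> set ys \<subseteq> S" "successively E xs"
      "\<And>u v. S = {u, v} \<Longrightarrow> {u, v} \<notin> path_edges xs" "card S \<le> 2" "finite S" for xs ys S
  proof (rule edges_image_Int)
    have "False" if e: "e \<in> path_edges xs" "e \<in> path_edges ys" for e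
    proof -
      obtain u v where uv: "e = {u, v}" "E u v" using path_edge_obtain[OF e(1) \<open>successively E xs\<close>] by metis
      have "e \<subseteq> S" using path_edge_subset[OF e(1)] path_edge_subset[OF e(2)] \<open>set xs \<inter> set ys \<subseteq> S\<close> by blast
      moreover have "card e = 2" using uv(1) edge_verts[OF uv(2)] by simp
      ultimately have "e = S" using \<open>card S \<le> 2\<close> \<open>finite S\<close> by (simp add: card_seteq)
      then show False using \<open>\<And>u v. S = {u, v} \<Longrightarrow> {u, v} \<notin> path_edges xs\<close> uv(1) e(1) by blast
    qed
    then show "path_edges xs \<inter> path_edges ys = {}" by blast
    show "\<Union> (path_edges xs) \<inter> \<Union> (path_edges ys) \<subseteq> S"
      using path_edge_subset[of _ xs] path_edge_subset[of _ ys] that(1) by blast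
  qed
  have pr: "{u, v} \<notin> path_edges ?P1" "{u, v} \<notin> path_edges ?P2" if "{p, r} = {u, v}" for u v
    using ends_not_path_edge[of p "X @ q # Y" r] ends_not_path_edge[of p "Z @ s # W" r] d(1,2) that by simp_all
  have noedge: "{u, v} \<notin> path_edges xs" if hyp: "{x} = {u, v}" "successively E xs" for u v x xs
  proof
    assume "{u, v} \<in> path_edges xs"
    then obtain a b where ab: "{u, v} = {a, b}" "E a b" using hyp(2) by (rule path_edge_obtain)
    then have "a \<in> {x}" "b \<in> {x}" using hyp(1) by auto
    then have "a = b" by simp
    then show False using edge_verts[OF ab(2)] by simp
  qed
  have "path_trace ?P1 \<inter> path_trace ?P2 \<subseteq> f ` {p, r}"
    using dist pr by (intro share P1) (auto simp: card_insert_if)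
  moreover have "path_trace ?P1 \<inter> path_trace ?Q \<subseteq> f ` {p, r}"
    using dist pr by (intro share P1) (auto simp: card_insert_if)
  moreover have "path_trace ?P2 \<inter> path_trace ?Q \<subseteq> f ` {p, r}"
    using dist pr by (intro share P2) (auto simp: card_insert_if)
  moreover have "f p \<in> path_image c1" "f r \<in> path_image c1" "f p \<in> path_image c2" "f r \<in> path_image c2"
    "f p \<in> path_image c3" "f r \<in> path_image c3"
    using c1(2,3) c2(2,3) c3(2,3) pathstart_in_path_image pathfinish_in_path_image by metis+
  ultimately interpret theta_curve c1 c2 c3 "f p" "f r"
    using c1 c2 c3 by unfold_locales auto
  have "path_trace ?R \<inter> path_trace ?P1 \<subseteq> f ` {q}"
    using dist noedge[OF _ R] by (intro share R) auto
  moreover have "f q \<in> path_image b" "f s \<in> path_image b"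
    using b(2,3) pathstart_in_path_image pathfinish_in_path_image by metis+
  moreover have "path_trace ?R \<inter> path_trace ?P2 \<subseteq> f ` {s}"
    using dist noedge[OF _ R] by (intro share R) auto
  moreover have "path_trace ?R \<inter> path_trace ?Q \<subseteq> f ` {}"
    using dist by (intro share R) auto
  moreover have "f q \<in> path_trace ?P1" "f s \<in> path_trace ?P2"
    using vertex_in_trace_iff[OF P1, of q] vertex_in_trace_iff[OF P2, of s] inV by auto
  moreover have "f q \<noteq> f p" "f q \<noteq> f r" "f s \<noteq> f p" "f s \<noteq> f r"
    using inV dist by (auto simp: inj_on_eq_iff[OF inj])
  ultimately have "z \<in> inside (path_image c1 \<union> path_image c2) \<longleftrightarrow>
      w \<notin> inside (path_image c1 \<union> path_image c2)"
    using b c1 c2 c3 z w by (intro chords_on_opposite_sides[of b "f q" "f s"]) auto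
  then show ?thesis using c1 c2 F by (simp add: edges_image_Un)
qed

lemma edge_interior_point:
  assumes "E u v"
  obtains z where "z \<in> path_trace [u, v]" "z \<noteq> f u" "z \<noteq> f v"
proof -
  have "path_image (g u v) - {f u, f v} \<noteq> {}"
    using edge_arc[OF assms] nonempty_simple_path_endless[of "g u v"] by (auto simp: arc_imp_simple_path)
  then show thesis using that edges_image_single[OF assms] by auto
qed

text \<open>This is \<open>K\<^sub>3\<^sub>,\<^sub>3\<close> as a hexagon with its three long
  diagonals. Any two of them have alternating ends, so they would need three different
  sides.\<close>

lemma K33_free:
  assumes "distinct [h0, h1, h2, h3, h4, h5]"
    and "E h0 h1" "E h1 h2" "E h2 h3" "E h3 h4" "E h4 h5" "E h5 h0" "E h0 h3" "E h1 h4" "E h2 h5"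
  shows False
proof -
  define F where "F = path_edges [h0, h1, h2, h3, h4, h5, h0]"
  obtain z0 where z0: "z0 \<in> path_trace [h0, h3]" "z0 \<noteq> f h0" "z0 \<noteq> f h3"
    using edge_interior_point assms by blast
  obtain z1 where z1: "z1 \<in> path_trace [h1, h4]" "z1 \<noteq> f h1" "z1 \<noteq> f h4"
    using edge_interior_point assms by blast
  obtain z2 where z2: "z2 \<in> path_trace [h2, h5]" "z2 \<noteq> f h2" "z2 \<noteq> f h5"
    using edge_interior_point assms by blast
  note sym = assms(2-)[THEN edge_sym]
  have "z0 \<in> inside (edges_image F) \<longleftrightarrow> z1 \<notin> inside (edges_image F)"
    using crossing_paths[of h0 "[]" h1 "[h2]" h3 "[h5]" h4 "[]" "[]" "[]" F z0 z1] assms sym z0 z1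
    by (auto simp: F_def insert_commute)
  moreover have "z0 \<in> inside (edges_image F) \<longleftrightarrow> z2 \<notin> inside (edges_image F)"
    using crossing_paths[of h0 "[h1]" h2 "[]" h3 "[]" h5 "[h4]" "[]" "[]" F z0 z2] assms sym z0 z2
    by (auto simp: F_def insert_commute)
  moreover have "z1 \<in> inside (edges_image F) \<longleftrightarrow> z2 \<notin> inside (edges_image F)"
    using crossing_paths[of h1 "[]" h2 "[h3]" h4 "[h0]" h5 "[]" "[]" "[]" F z1 z2] assms sym z1 z2
    by (auto simp: F_def insert_commute)
  ultimately show False by blast
qed

end

lemma planar_imp_drawing:
  fixes V :: "'v set"
  assumes "planar V E" and verts: "\<And>u v. E u v \<Longrightarrow> u \<in> V \<and> v \<in> V \<and> u \<noteq> v \<and> E v u"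
  obtains f g where "plane_drawing V E f g"
proof -
  obtain f :: "'v \<Rightarrow> complex" and g where "inj_on f V \<and>
     (\<forall>u v. E u v \<longrightarrow> arc (g u v) \<and> pathstart (g u v) = f u \<and> pathfinish (g u v) = f v) \<and>
     (\<forall>u v w. E u v \<and> w \<in> V \<and> w \<noteq> u \<and> w \<noteq> v \<longrightarrow> f w \<notin> path_image (g u v)) \<and>
     (\<forall>u v x y. E u v \<and> E x y \<and> {u, v} \<noteq> {x, y} \<longrightarrow>
        path_image (g u v) \<inter> path_image (g x y) \<subseteq> f ` ({u, v} \<inter> {x, y}))"
    using assms(1) unfolding planar_def by (elim exE) (rule that)
  then have d: "inj_on f V"
    "\<And>u v. E u v \<Longrightarrow> arc (g u v) \<and> pathstart (g u v) = f u \<and> pathfinish (g u v) = f v"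
    "\<And>u v w. E u v \<Longrightarrow> w \<in> V \<Longrightarrow> w \<noteq> u \<Longrightarrow> w \<noteq> v \<Longrightarrow> f w \<notin> path_image (g u v)"
    "\<And>u v x y. E u v \<Longrightarrow> E x y \<Longrightarrow> {u, v} \<noteq> {x, y} \<Longrightarrow>
        path_image (g u v) \<inter> path_image (g x y) \<subseteq> f ` ({u, v} \<inter> {x, y})"
    by simp_all
  \<comment> \<open>A chosen end of the edge \<open>e\<close>, at which its drawing starts; the name
    hides the list function.\<close>
  define tl where "tl e = (SOME u. \<exists>v. e = {u, v} \<and> E u v)" for e
  \<comment> \<open>The two orientations of an edge may be drawn differently; \<open>h\<close> uses one of them for both.\<close>
  define h where "h u v = (if tl {u, v} = u then g u v else reversepath (g v u))" for u v
  have h: "h u v = g u v \<or> h u v = reversepath (g v u)" for u v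
    unfolding h_def by auto
  have "plane_drawing V E f h"
  proof
    fix u v assume uv: "E u v"
    have "\<exists>y. {u, v} = {tl {u, v}, y} \<and> E (tl {u, v}) y"
      unfolding tl_def using uv by (intro someI[of "\<lambda>x. \<exists>y. {u, v} = {x, y} \<and> E x y" u]) blast
    then have "tl {u, v} = u \<or> tl {u, v} = v" by (auto simp: doubleton_eq_iff)
    then show "path_image (h v u) = path_image (h u v)"
      using verts[OF uv] by (auto simp: h_def insert_commute)
    show "arc (h u v) \<and> pathstart (h u v) = f u \<and> pathfinish (h u v) = f v"
      using d(2)[of u v] d(2)[of v u] uv verts[OF uv] h[of u v] by (auto simp: arc_reversepath)
    have img: "path_image (h x y) = path_image (g x y) \<or> path_image (h x y) = path_image (g y x)" for x y
      using h[of x y] by auto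
    show "w = u \<or> w = v" if "w \<in> V" "f w \<in> path_image (h u v)" for w
      using d(3)[of u v w] d(3)[of v u w] that uv verts[OF uv] img[of u v] by metis
    show "path_image (h u v) \<inter> path_image (h x y) \<subseteq> f ` ({u, v} \<inter> {x, y})"
      if xy: "E x y" "{u, v} \<noteq> {x, y}" for x y
    proof -
      have *: "path_image (g a b) \<inter> path_image (g a' b') \<subseteq> f ` ({u, v} \<inter> {x, y})"
        if "{a, b} = {u, v}" "{a', b'} = {x, y}" "E a b" "E a' b'" for a b a' b'
        using d(4)[OF that(3,4)] that(1,2) xy(2) by simp
      have "E v u" "E y x" using verts uv xy by auto
      then show ?thesis
        using *[of u v x y] *[of v u x y] *[of u v y x] *[of v u y x] uv xy(1) img[of u v] img[of x y]
        by (auto simp: insert_commute)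
    qed
  qed (use verts d(1) in auto)
  then show thesis using that by blast
qed

subsection \<open>Drawings of a great shadow\<close>

lemma shadow_adj_verts:
  assumes "simple_graph V E" "shadow_adj V E a b"
  shows "a \<in> shadow_verts V \<and> b \<in> shadow_verts V \<and> a \<noteq> b \<and> shadow_adj V E b a"
  using assms unfolding simple_graph_def shadow_verts_def by (cases a; cases b) auto

locale shadow_drawing =
  fixes V :: "'a set" and E f g
  assumes graph: "simple_graph V E"
    and drawing: "plane_drawing (shadow_verts V) (shadow_adj V E) f g"
begin

sublocale plane_drawing "shadow_verts V" "shadow_adj V E" f g by (rule drawing)

lemma E_props: "E u v \<Longrightarrow> u \<in> V \<and> v \<in> V \<and> u \<noteq> v \<and> E v u"
  using graph unfolding simple_graph_def by blast

lemma lift_walk: "successively E xs \<Longrightarrow> successively (shadow_adj V E) (map Inl xs)"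
  by (simp add: successively_map)

lemma vertex_neq:
  assumes "a \<in> shadow_verts V" "b \<in> shadow_verts V" "a \<noteq> b"
  shows "f a \<noteq> f b"
  using inj assms by (meson inj_on_eq_iff)

lemma no_theta:
  assumes dist: "distinct (x # y # A1 @ A2 @ A3)"
    and P1: "successively E (x # A1 @ [y])" and P2: "successively E (x # A2 @ [y])"
    and P3: "successively E (x # A3 @ [y])" and ne: "A1 \<noteq> []" "A2 \<noteq> []"
  shows False
proof -
  obtain a1 A1' where A1: "A1 = a1 # A1'" using ne by (cases A1) auto
  obtain a2 A2' where A2: "A2 = a2 # A2'" using ne by (cases A2) auto
  obtain b1 B1 where B1: "A1 = B1 @ [b1]" using ne by (cases A1 rule: rev_cases) auto
  obtain b2 B2 where B2: "A2 = B2 @ [b2]" using ne by (cases A2 rule: rev_cases) auto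
  have "successively E ((x # B1) @ [b1, y])" "successively E ((x # B2) @ [b2, y])"
    using P1 P2 by (simp_all add: B1 B2)
  then have "E b1 y" "E b2 y" unfolding successively_append_iff by auto
  moreover have "E x a1" "E x a2" using P1 P2 by (simp_all add: A1 A2)
  ultimately have ed: "E x a1" "E x a2" "E b1 y" "E b2 y" by blast+
  define F :: "('a + 'a) set set" where "F = path_edges (map Inl (x # A1 @ [y])) \<union> path_edges (map Inl (x # A2 @ [y]))"
  note V = ed[THEN E_props]
  have SV: "Inl x \<in> shadow_verts V" "Inr x \<in> shadow_verts V" "Inl y \<in> shadow_verts V" "Inr y \<in> shadow_verts V"
    "Inl a1 \<in> shadow_verts V" "Inl a2 \<in> shadow_verts V" "Inl b1 \<in> shadow_verts V" "Inl b2 \<in> shadow_verts V"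
    using V unfolding shadow_verts_def by auto
  note lifts = lift_walk[OF P1] lift_walk[OF P2] lift_walk[OF P3]
  have R: "successively (shadow_adj V E) [Inl a1, Inr x, Inl a2]"
    "successively (shadow_adj V E) [Inl b1, Inr y, Inl b2]"
    using V ed by auto
  have x_in: "f (Inr x) \<in> path_trace [Inl a1, Inr x, Inl a2]"
    using vertex_in_trace_iff[OF R(1) SV(2)] by simp
  have y_in: "f (Inr y) \<in> path_trace [Inl b1, Inr y, Inl b2]"
    using vertex_in_trace_iff[OF R(2) SV(4)] by simp
  have neq: "f (Inr x) \<noteq> f (Inl a1)" "f (Inr x) \<noteq> f (Inl a2)" "f (Inr y) \<noteq> f (Inl b1)"
    "f (Inr y) \<noteq> f (Inl b2)" "f (Inr x) \<noteq> f (Inl x)" "f (Inr x) \<noteq> f (Inl y)"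
    by (rule vertex_neq; use SV in simp)+
  \<comment> \<open>Going round the cycle, \<open>x\<close> separates \<open>a1\<close> from
    \<open>a2\<close>, with \<open>y\<close> on the remaining part. So the path from
    \<open>a1\<close> over the shadow of \<open>x\<close> to \<open>a2\<close> alternates with the
    third path.\<close>
  have x_side: "z \<in> inside (edges_image F) \<longleftrightarrow> f (Inr x) \<notin> inside (edges_image F)"
    if "z \<in> path_trace (map Inl (x # A3 @ [y]))" "z \<noteq> f (Inl x)" "z \<noteq> f (Inl y)" for z
  proof (rule crossing_paths[of "Inl x" "[]" "Inl a1" "map Inl A1'" "Inl y" "[]" "Inl a2" "map Inl A2'"
        "map Inl A3" "[Inr x]"])
    show "distinct (Inl x # Inl a1 # Inl y # Inl a2 # [] @ map Inl A1' @ [] @ map Inl A2' @ map Inl A3 @ [Inr x])"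
      using dist by (auto simp: A1 A2 distinct_map)
  qed (use lifts R x_in that neq in \<open>simp_all add: F_def A1 A2\<close>)
  show False
  proof (cases A3)
    case (Cons a3 A3')
    then have x_a3: "E x a3" using P3 by simp
    then have a3: "Inl a3 \<in> shadow_verts V" using E_props unfolding shadow_verts_def by auto
    have adj: "shadow_adj V E (Inr x) (Inl a3)" using x_a3 by simp
    have "f (Inl a3) \<in> inside (edges_image F) \<longleftrightarrow> f (Inr x) \<notin> inside (edges_image F)"
      using dist a3 SV vertex_in_trace_iff[OF lifts(3) a3] Cons by (intro x_side vertex_neq) auto
    moreover have "f (Inr x) \<in> inside (edges_image F) \<longleftrightarrow> f (Inl a3) \<in> inside (edges_image F)"
    proof (rule connected_inside_iff)
      show "connected (path_image (g (Inr x) (Inl a3)))" using edge_arc[OF adj] connected_arc_image by blast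
      have "edges_image {{Inr x, Inl a3}} \<inter> edges_image F \<subseteq> f ` {}"
      proof (rule edges_image_Int)
        have "e \<subseteq> set (map Inl (x # A1 @ [y])) \<union> set (map Inl (x # A2 @ [y]))" if "e \<in> F" for e
          using that path_edge_subset unfolding F_def by blast
        then have "\<Union>F \<subseteq> set (map Inl (x # A1 @ [y])) \<union> set (map Inl (x # A2 @ [y]))" by blast
        then have "Inr x \<notin> \<Union>F" "Inl a3 \<notin> \<Union>F" using dist Cons by auto
        then show "{{Inr x, Inl a3}} \<inter> F = {}" "\<Union>{{Inr x, Inl a3}} \<inter> \<Union>F \<subseteq> {}" by blast+
      qed
      then show "path_image (g (Inr x) (Inl a3)) \<inter> edges_image F = {}"
        using edges_image_single[OF adj] by simp
    qed (use edge_arc[OF adj] pathstart_in_path_image pathfinish_in_path_image in metis)+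
    ultimately show False by blast
  next
    case Nil
    then have "shadow_adj V E (Inl x) (Inl y)" using P3 by simp
    then obtain z where z: "z \<in> path_trace [Inl x, Inl y]" "z \<noteq> f (Inl x)" "z \<noteq> f (Inl y)"
      by (rule edge_interior_point)
    have xy: "E x y" using P3 Nil by simp
    have "z \<in> inside (edges_image F) \<longleftrightarrow> f (Inr x) \<notin> inside (edges_image F)"
      using x_side[of z] z Nil by simp
    moreover have "z \<in> inside (edges_image F) \<longleftrightarrow> f (Inr y) \<notin> inside (edges_image F)"
    proof (rule crossing_paths[of "Inl x" "map Inl B1" "Inl b1" "[]" "Inl y" "map Inl B2" "Inl b2" "[]"
          "[]" "[Inr y]"])
      show "distinct (Inl x # Inl b1 # Inl y # Inl b2 # map Inl B1 @ [] @ map Inl B2 @ [] @ [] @ [Inr y])"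
        using dist by (auto simp: B1 B2 distinct_map)
    qed (use lifts R y_in z neq xy in \<open>simp_all add: F_def B1 B2\<close>)
    \<comment> \<open>As \<open>x\<close> and \<open>y\<close> are adjacent, \<open>x\<close>, its
      shadow and \<open>y\<close> form another path that alternates with the one over the shadow of
      \<open>y\<close>. Now \<open>z\<close> and the two shadows are pairwise separated by one
      cycle.\<close>
    moreover have "f (Inr x) \<in> inside (edges_image F) \<longleftrightarrow> f (Inr y) \<notin> inside (edges_image F)"
    proof -
      have R': "successively (shadow_adj V E) [Inl x, Inr x, Inl y]"
        using V xy by auto
      then have x_in': "f (Inr x) \<in> path_trace [Inl x, Inr x, Inl y]"
        using vertex_in_trace_iff[OF R' SV(2)] by simp
      show ?thesis
      proof (rule crossing_paths[of "Inl x" "map Inl B1" "Inl b1" "[]" "Inl y" "map Inl B2" "Inl b2" "[]"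
            "[Inr x]" "[Inr y]"])
        show "distinct (Inl x # Inl b1 # Inl y # Inl b2 # map Inl B1 @ [] @ map Inl B2 @ [] @ [Inr x] @ [Inr y])"
          using dist by (auto simp: B1 B2 distinct_map)
      qed (use lifts R R' y_in x_in' neq in \<open>simp_all add: F_def B1 B2\<close>)
    qed
    ultimately show False by blast
  qed
qed

text \<open>The shadow of \<open>q\<close> is the middle of a path from \<open>p\<close> to
  \<open>r\<close>, and that of \<open>r\<close> the middle of one from \<open>q\<close> to
  \<open>s\<close>; the ends alternate on the cycle. The list pattern forces at least four vertices,
  so \<open>p\<close> and \<open>s\<close> differ.\<close>

lemma consecutive_shadows_on_opposite_sides:
  assumes c: "is_cycle E (q # r # s # rest @ [p])"
  defines "F \<equiv> cycle_edges (map Inl (q # r # s # rest @ [p]))"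
  shows "f (Inr q) \<in> inside (edges_image F) \<longleftrightarrow> f (Inr r) \<notin> inside (edges_image F)"
proof -
  have dist: "distinct (q # r # s # rest @ [p])" and walk: "successively E (q # r # s # rest @ [p, q])"
    using c unfolding is_cycle_conv by auto
  have ed: "E p q" "E q r" "E r s" using walk by (auto simp: successively_append_iff successively_Cons)
  note V = ed[THEN E_props]
  have SV: "Inl p \<in> shadow_verts V" "Inl q \<in> shadow_verts V" "Inl r \<in> shadow_verts V" "Inl s \<in> shadow_verts V"
    "Inr q \<in> shadow_verts V" "Inr r \<in> shadow_verts V"
    using V unfolding shadow_verts_def by auto
  have R: "successively (shadow_adj V E) [Inl p, Inr q, Inl r]"
    "successively (shadow_adj V E) [Inl q, Inr r, Inl s]"
    using V ed by auto
  have q_in: "f (Inr q) \<in> path_trace [Inl p, Inr q, Inl r]"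
    using vertex_in_trace_iff[OF R(1) SV(5)] by simp
  have r_in: "f (Inr r) \<in> path_trace [Inl q, Inr r, Inl s]"
    using vertex_in_trace_iff[OF R(2) SV(6)] by simp
  have P1: "successively (shadow_adj V E) [Inl p, Inl q, Inl r]" using ed by auto
  have "successively E (r # s # rest @ [p])"
    using walk successively_append_iff[of E "r # s # rest @ [p]" "[q]"] by simp
  then have "successively E (rev (r # s # rest @ [p]))" using successively_rev_sym[of E] E_props by blast
  then have P2: "successively (shadow_adj V E) (Inl p # map Inl (rev rest) @ Inl s # [] @ [Inl r])"
    using lift_walk by fastforce
  have "path_edges ((Inl p :: 'a + 'a) # map Inl (rev rest) @ Inl s # [] @ [Inl r]) =
      path_edges (rev (Inl r # Inl s # map Inl rest @ [Inl p]))" by (simp add: rev_map)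
  then have P2_edges: "path_edges ((Inl p :: 'a + 'a) # map Inl (rev rest) @ Inl s # [] @ [Inl r]) =
      path_edges (Inl r # Inl s # map Inl rest @ [Inl p])"
    unfolding path_edges_rev by simp
  have F: "F = path_edges [Inl p, Inl q, Inl r] \<union> path_edges (Inl p # map Inl (rev rest) @ Inl s # [] @ [Inl r])"
  proof -
    have "map Inl (q # r # s # rest @ [p]) @ [Inl q] =
        [Inl q] @ (Inl r # Inl s # map Inl rest @ [Inl p]) @ [Inl q]" by simp
    then show ?thesis
      unfolding F_def cycle_edges_conv P2_edges by (simp add: path_edges_append insert_commute del: append_Cons)
  qed
  show ?thesis
  proof (rule crossing_paths[of "Inl p" "[]" "Inl q" "[]" "Inl r" "map Inl (rev rest)" "Inl s" "[]"
        "[Inr q]" "[Inr r]"])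
    show "distinct (Inl p # Inl q # Inl r # Inl s # [] @ [] @ map Inl (rev rest) @ [] @ [Inr q] @ [Inr r])"
      using dist by (auto simp: distinct_map)
    show "F = path_edges (Inl p # [] @ Inl q # [] @ [Inl r]) \<union>
        path_edges (Inl p # map Inl (rev rest) @ Inl s # [] @ [Inl r])"
      unfolding F by simp
    show "successively (shadow_adj V E) (Inl p # map Inl (rev rest) @ Inl s # [] @ [Inl r])" by (rule P2)
  qed (use P1 R q_in r_in SV in \<open>simp_all add: vertex_neq\<close>)
qed

lemma no_odd_cycle:
  assumes c: "is_cycle E c" and "odd (length c)"
  shows False
proof (cases "length c = 3")
  case True
  then obtain u v w where uvw: "c = [u, v, w]"
    by (metis (no_types, lifting) length_0_conv length_Suc_conv numeral_3_eq_3)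
  then have "E u v" "E v w" "E w u" "distinct [u, v, w]"
    using c unfolding is_cycle_conv by auto
  \<comment> \<open>In the shadow of a triangle every original vertex is adjacent to all three
    shadows; the hexagon alternates between the two classes.\<close>
  then show False
    using E_props[of u v] E_props[of v w] E_props[of w u]
    by (intro K33_free[of "Inl u" "Inr u" "Inl v" "Inr v" "Inl w" "Inr w"]) auto
next
  case False
  define n where "n = length c"
  have n: "n \<ge> 5" "odd n"
  proof -
    show "odd n" using assms(2) n_def by simp
    have "n \<ge> 3" "n \<noteq> 3" using c False unfolding is_cycle_def n_def by auto
    then show "n \<ge> 5" using \<open>odd n\<close> by presburger
  qed
  define F where "F = cycle_edges (map (Inl :: 'a \<Rightarrow> 'a + 'a) c)"
  have "even n"
  proof (rule alternating_cycle_even[where s = "\<lambda>i. f (Inr (c ! i)) \<in> inside (edges_image F)"])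
    fix i assume i: "i < n"
    \<comment> \<open>Rotation brings position \<open>i\<close> to the front and keeps the cycle
      edges, so the same curve is used for every pair of consecutive shadows.\<close>
    define w where "w = drop i c @ take i c"
    have w: "is_cycle E w" "length w = n"
      using is_cycle_append_commute[of E "take i c" "drop i c"] c i unfolding w_def n_def by auto
    have w_nth: "w ! j = c ! ((j + i) mod n)" if "j < n" for j
      using rotate_drop_take[of i c] i nth_rotate[of j c i] that unfolding w_def n_def by (simp add: add.commute)
    have "cycle_edges (map Inl w) = F"
      using cycle_edges_append_commute[of "map Inl (drop i c)" "map Inl (take i c)"]
      unfolding F_def w_def by (simp flip: map_append)
    moreover obtain q r s rest p where qr: "w = q # r # s # rest @ [p]"
    proof -
      obtain q r s t ws where 1: "w = q # r # s # t # ws"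
      proof -
        have "Suc (Suc (Suc (Suc 0))) \<le> length w" using w(2) n(1) by simp
        then show thesis unfolding Suc_le_length_iff using that by blast
      qed
      obtain rest p where "t # ws = rest @ [p]" by (metis append_butlast_last_id list.distinct(1))
      then show thesis using that 1 by metis
    qed
    ultimately have "f (Inr q) \<in> inside (edges_image F) \<longleftrightarrow> f (Inr r) \<notin> inside (edges_image F)"
      using consecutive_shadows_on_opposite_sides[of q r s rest p] w(1) by simp
    moreover have "q = c ! i" "r = c ! ((i + 1) mod n)"
      using w_nth[of 0] w_nth[of 1] i n(1) qr by (auto simp: add.commute)
    ultimately show "(f (Inr (c ! ((i + 1) mod n))) \<in> inside (edges_image F)) =
        (\<not> f (Inr (c ! i)) \<in> inside (edges_image F))" by blast
  qed (use n in auto)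
  then show False using n by blast
qed

end

lemma planar_shadow_imp_bipartite_cactus:
  assumes "simple_graph V E" "connected_graph V E" "planar (shadow_verts V) (shadow_adj V E)"
  shows "bipartite_cactus V E"
proof -
  obtain f g where "plane_drawing (shadow_verts V) (shadow_adj V E) f g"
    using planar_imp_drawing[OF assms(3)] shadow_adj_verts[OF assms(1)] by metis
  then interpret shadow_drawing V E f g using assms(1) by (intro shadow_drawing.intro)
  have "cactus V E" using not_cactus_imp_theta[of E V] E_props no_theta by metis
  moreover have "bipartite V E" using not_bipartite_imp_odd_cycle[OF assms(1,2)] no_odd_cycle by metis
  ultimately show ?thesis unfolding bipartite_cactus_def by simp
qed

subsection \<open>Book drawings\<close>

text \<open>Only alternating ends are forbidden; the strict inequalities let arcs with a common end
  and nested arcs share a page.\<close>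

definition noncrossing :: "('b \<Rightarrow> real) \<Rightarrow> ('b \<Rightarrow> 'b \<Rightarrow> bool) \<Rightarrow> bool" where
  "noncrossing pos R \<longleftrightarrow> (\<forall>a b c d. R a b \<longrightarrow> R c d \<longrightarrow> \<not> (pos a < pos c \<and> pos c < pos b \<and> pos b < pos d))"

text \<open>Above the real number \<open>x\<close> its height is
  \<open>h * ((x - a) * (b - x))\<close>. The sign of \<open>h\<close> selects the page, and a
  common leading coefficient on each page makes nested arcs comparable.\<close>

definition parabola :: "real \<Rightarrow> real \<Rightarrow> real \<Rightarrow> real \<Rightarrow> complex" where
  "parabola h a b t = Complex (a + (b - a) * t) (h * ((b - a)\<^sup>2 * (t * (1 - t))))"

lemma parabola_ends [simp]:
  "pathstart (parabola h a b) = of_real a" "pathfinish (parabola h a b) = of_real b"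
  by (simp_all add: pathstart_def pathfinish_def parabola_def complex_eq_iff)

lemma arc_parabola:
  assumes "a \<noteq> b"
  shows "arc (parabola h a b)"
proof -
  have "continuous_on {0..1} (parabola h a b)"
    unfolding parabola_def Complex_eq by (intro continuous_intros)
  moreover have "inj_on (parabola h a b) {0..1}"
    using assms by (auto simp: inj_on_def parabola_def)
  ultimately show ?thesis by (simp add: arc_def path_def)
qed

lemma parabola_image:
  assumes "z \<in> path_image (parabola h a b)"
  shows "min a b \<le> Re z" "Re z \<le> max a b" "Im z = h * ((Re z - a) * (b - Re z))"
proof -
  obtain t where t: "0 \<le> t" "t \<le> 1" and z: "z = parabola h a b t"
    using assms by (auto simp: path_image_def)
  have re: "Re z = (1 - t) * a + t * b" by (simp add: z parabola_def algebra_simps)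
  have "min a b \<le> Re z \<and> Re z \<le> max a b"
  proof -
    have "min a b = (1 - t) * min a b + t * min a b" "max a b = (1 - t) * max a b + t * max a b"
      by (simp_all add: algebra_simps)
    moreover have "(1 - t) * min a b \<le> (1 - t) * a" "t * min a b \<le> t * b"
      "(1 - t) * a \<le> (1 - t) * max a b" "t * b \<le> t * max a b"
      using t by (auto intro!: mult_left_mono)
    ultimately show ?thesis unfolding re by linarith
  qed
  then show "min a b \<le> Re z" "Re z \<le> max a b" by auto
  show "Im z = h * ((Re z - a) * (b - Re z))"
    by (simp add: z parabola_def power2_eq_square algebra_simps)
qed

text \<open>Widening the interval enlarges both factors of \<open>(x - a) * (b - x)\<close>, so over
  the inner interval the outer parabola is strictly higher except at a shared end.\<close>

lemma nested_parabolas_meet: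
  fixes a b c d x :: real
  assumes "a \<le> c" "c \<le> x" "x \<le> d" "d \<le> b" "a < c \<or> d < b"
    and eq: "(x - a) * (b - x) = (x - c) * (d - x)"
  shows "(x = a \<or> x = b) \<and> (x = c \<or> x = d)"
proof (cases "a < c")
  case True
  have "\<not> x < b"
  proof
    assume "x < b"
    then have "(x - c) * (b - x) < (x - a) * (b - x)" using True by (intro mult_strict_right_mono) auto
    moreover have "(x - c) * (d - x) \<le> (x - c) * (b - x)" using assms by (intro mult_left_mono) auto
    ultimately show False using eq by simp
  qed
  then show ?thesis using assms by auto
next
  case False
  have "\<not> a < x"
  proof
    assume "a < x"
    then have "(x - a) * (d - x) < (x - a) * (b - x)" using assms False by (intro mult_strict_left_mono) auto
    moreover have "(x - c) * (d - x) \<le> (x - a) * (d - x)" using assms by (intro mult_right_mono) auto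
    ultimately show False using eq by simp
  qed
  then show ?thesis using assms by auto
qed

lemma parabolas_meet:
  fixes a b c d x :: real
  assumes "{a, b} \<noteq> {c, d}" "min a b \<le> x" "x \<le> max a b" "min c d \<le> x" "x \<le> max c d"
    and eq: "(x - a) * (b - x) = (x - c) * (d - x)"
    and nc: "\<not> (min a b < min c d \<and> min c d < max a b \<and> max a b < max c d)"
      "\<not> (min c d < min a b \<and> min a b < max c d \<and> max c d < max a b)"
  shows "x \<in> {a, b} \<inter> {c, d}"
proof -
  define a' b' c' d' where "a' = min a b" and "b' = max a b" and "c' = min c d" and "d' = max c d"
  have eq': "(x - a') * (b' - x) = (x - c') * (d' - x)"
    using eq unfolding a'_def b'_def c'_def d'_def min_def max_def by (auto simp: algebra_simps)
  have ne: "a' \<noteq> c' \<or> b' \<noteq> d'"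
    using assms(1) unfolding a'_def b'_def c'_def d'_def min_def max_def by (auto split: if_splits)
  note x = assms(2-5)[folded a'_def b'_def c'_def d'_def] and nc' = nc[folded a'_def b'_def c'_def d'_def]
  have "(x = a' \<or> x = b') \<and> (x = c' \<or> x = d')"
  proof -
    consider "b' \<le> c'" | "d' \<le> a'" | "a' \<le> c'" "d' \<le> b'" | "c' \<le> a'" "b' \<le> d'"
      using nc' by linarith
    then show ?thesis
    proof cases
      case 3 then show ?thesis using nested_parabolas_meet[of a' c' x d' b'] x ne eq' by linarith
    next
      case 4 then show ?thesis using nested_parabolas_meet[of c' a' x b' d'] x ne eq' by linarith
    qed (use x in auto)
  qed
  then show ?thesis unfolding a'_def b'_def c'_def d'_def min_def max_def by (auto split: if_splits)
qed

lemma noncrossing_min_max: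
  assumes "noncrossing pos R" "\<And>a b. R a b \<Longrightarrow> R b a" "R u v" "R x y"
  shows "\<not> (min (pos u) (pos v) < min (pos x) (pos y) \<and> min (pos x) (pos y) < max (pos u) (pos v) \<and>
    max (pos u) (pos v) < max (pos x) (pos y))"
proof -
  have key: "\<not> (pos a < pos c \<and> pos c < pos b \<and> pos b < pos d)" if "R a b" "R c d" for a b c d
    using assms(1) that unfolding noncrossing_def by blast
  have R: "R v u" "R y x" using assms by auto
  show ?thesis
    using key[OF assms(3,4)] key[OF assms(3) R(2)] key[OF R(1) assms(4)] key[OF R]
    unfolding min_def max_def by auto
qed

lemma book_planar:
  assumes inj: "inj_on pos N"
    and verts: "\<And>a b. T a b \<or> B a b \<Longrightarrow> a \<in> N \<and> b \<in> N \<and> a \<noteq> b"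
    and sym: "\<And>a b. T a b \<Longrightarrow> T b a" "\<And>a b. B a b \<Longrightarrow> B b a"
    and nc: "noncrossing pos T" "noncrossing pos B"
  shows "planar N (\<lambda>a b. T a b \<or> B a b)"
proof -
  define f :: "'a \<Rightarrow> complex" where "f a = of_real (pos a)" for a
  \<comment> \<open>A pair that is in both \<open>T\<close> and \<open>B\<close> is one edge and is
    drawn above the axis.\<close>
  define h :: "'a \<Rightarrow> 'a \<Rightarrow> real" where "h a b = (if T a b then 1 else - 1)" for a b
  define g where "g a b = parabola (h a b) (pos a) (pos b)" for a b
  have on_axis: "z = f a \<or> z = f b" if "z \<in> path_image (g a b)" "Im z = 0" for z a b
  proof -
    have "h a b * ((Re z - pos a) * (pos b - Re z)) = 0"
      using parabola_image(3)[of z "h a b"] that unfolding g_def by simp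
    then show ?thesis using that(2) by (auto simp: h_def f_def complex_eq_iff split: if_splits)
  qed
  have f_eq: "a = b" if "f a = f b" "a \<in> N" "b \<in> N" for a b
    using that inj by (simp add: f_def inj_on_eq_iff)
  have axis_meet: "z \<in> f ` ({u, v} \<inter> {x, y})"
    if "T u v \<or> B u v" "T x y \<or> B x y" "z \<in> path_image (g u v)" "z \<in> path_image (g x y)" "Im z = 0"
    for u v x y z
    using on_axis[OF that(3,5)] on_axis[OF that(4,5)] f_eq verts[OF that(1)] verts[OF that(2)] by auto
  have meet: "path_image (g u v) \<inter> path_image (g x y) \<subseteq> f ` ({u, v} \<inter> {x, y})"
    if uv: "T u v \<or> B u v" and xy: "T x y \<or> B x y" and ne: "{u, v} \<noteq> {x, y}" for u v x y
  proof
    fix z assume "z \<in> path_image (g u v) \<inter> path_image (g x y)"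
    then have z: "z \<in> path_image (g u v)" "z \<in> path_image (g x y)" by auto
    note im1 = parabola_image[OF z(1)[unfolded g_def]] and im2 = parabola_image[OF z(2)[unfolded g_def]]
    have nonneg: "(Re z - pos u) * (pos v - Re z) \<ge> 0" "(Re z - pos x) * (pos y - Re z) \<ge> 0"
      using im1(1,2) im2(1,2) by (auto simp: zero_le_mult_iff min_def max_def split: if_splits)
    show "z \<in> f ` ({u, v} \<inter> {x, y})"
    proof (cases "h u v = h x y")
      case False
      then have "h u v = 1 \<and> h x y = - 1 \<or> h u v = - 1 \<and> h x y = 1"
        unfolding h_def by (auto split: if_splits)
      moreover obtain A C where "Im z = h u v * A" "Im z = h x y * C" "A \<ge> 0" "C \<ge> 0"
        using im1(3) im2(3) nonneg by blast
      ultimately have "Im z = 0" by auto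
      then show ?thesis using axis_meet uv xy z by blast
    next
      case True
      define R where "R = (if T u v then T else B)"
      have "R u v \<and> R x y"
        using True uv xy unfolding R_def h_def by (auto split: if_splits)
      moreover have "noncrossing pos R" using nc unfolding R_def by simp
      moreover have "\<And>a b. R a b \<Longrightarrow> R b a" using sym unfolding R_def by metis
      ultimately have R: "R u v" "R x y" "noncrossing pos R" "\<And>a b. R a b \<Longrightarrow> R b a" by blast+
      have pos_ne: "{pos u, pos v} \<noteq> {pos x, pos y}"
        using ne verts[OF uv] verts[OF xy] inj by (auto simp: doubleton_eq_iff inj_on_eq_iff)
      have "h u v * ((Re z - pos u) * (pos v - Re z)) = h u v * ((Re z - pos x) * (pos y - Re z))"
        by (metis im1(3) im2(3) True)
      moreover have "h u v \<noteq> 0" by (simp add: h_def)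
      ultimately have eq: "(Re z - pos u) * (pos v - Re z) = (Re z - pos x) * (pos y - Re z)"
        by (rule mult_left_cancel[THEN iffD1, rotated])
      have "Re z \<in> {pos u, pos v} \<inter> {pos x, pos y}"
        by (rule parabolas_meet[OF pos_ne im1(1,2) im2(1,2) eq
              noncrossing_min_max[OF R(3,4) R(1,2)] noncrossing_min_max[OF R(3,4) R(2,1)]])
      then have "Im z = 0" using im1(3) by auto
      then show ?thesis using axis_meet uv xy z by blast
    qed
  qed
  show ?thesis
    unfolding planar_def
  proof (intro exI[of _ f] exI[of _ g] conjI allI impI)
    show "inj_on f N" using f_eq by (auto simp: inj_on_def)
    fix u v assume uv: "T u v \<or> B u v"
    show "arc (g u v)"
      using verts[OF uv] inj unfolding g_def by (intro arc_parabola) (auto simp: inj_on_eq_iff)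
    show "pathstart (g u v) = f u" "pathfinish (g u v) = f v" by (simp_all add: g_def f_def)
  next
    fix u v w assume *: "(T u v \<or> B u v) \<and> w \<in> N \<and> w \<noteq> u \<and> w \<noteq> v"
    show "f w \<notin> path_image (g u v)"
      using on_axis[of "f w" u v] * verts[of u v] f_eq by (auto simp: f_def)
  next
    fix u v x y assume "(T u v \<or> B u v) \<and> (T x y \<or> B x y) \<and> {u, v} \<noteq> {x, y}"
    then show "path_image (g u v) \<inter> path_image (g x y) \<subseteq> f ` ({u, v} \<inter> {x, y})" using meet by blast
  qed
qed

text \<open>Since \<open>m\<close> has no neighbours besides \<open>h u\<close> and
  \<open>h v\<close>, it determines the edge that it subdivides. Different edges therefore have
  different middle vertices, and their composite arcs meet only at images of common ends.\<close>

lemma planar_suppress_vertices: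
  fixes N :: "'b set" and V :: "'v set" and h :: "'v \<Rightarrow> 'b"
  assumes planar: "planar N R" and irrefl: "\<And>a b. R a b \<Longrightarrow> a \<noteq> b"
    and h: "inj_on h V" "h ` V \<subseteq> N"
    and verts: "\<And>u v. E u v \<Longrightarrow> u \<in> V \<and> v \<in> V \<and> u \<noteq> v"
    and edges: "\<And>u v. E u v \<Longrightarrow> R (h u) (h v) \<or>
      (\<exists>m. m \<notin> h ` V \<and> R (h u) m \<and> R m (h v) \<and> {y. R m y} = {h u, h v})"
  shows "planar V E"
proof -
  obtain f :: "'b \<Rightarrow> complex" and g where "inj_on f N \<and>
     (\<forall>u v. R u v \<longrightarrow> arc (g u v) \<and> pathstart (g u v) = f u \<and> pathfinish (g u v) = f v) \<and>
     (\<forall>u v w. R u v \<and> w \<in> N \<and> w \<noteq> u \<and> w \<noteq> v \<longrightarrow> f w \<notin> path_image (g u v)) \<and>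
     (\<forall>u v x y. R u v \<and> R x y \<and> {u, v} \<noteq> {x, y} \<longrightarrow>
        path_image (g u v) \<inter> path_image (g x y) \<subseteq> f ` ({u, v} \<inter> {x, y}))"
    using planar unfolding planar_def by (elim exE) (rule that)
  then have d: "inj_on f N"
    "\<And>u v. R u v \<Longrightarrow> arc (g u v) \<and> pathstart (g u v) = f u \<and> pathfinish (g u v) = f v"
    "\<And>u v w. R u v \<Longrightarrow> w \<in> N \<Longrightarrow> w \<noteq> u \<Longrightarrow> w \<noteq> v \<Longrightarrow> f w \<notin> path_image (g u v)"
    "\<And>u v x y. R u v \<Longrightarrow> R x y \<Longrightarrow> {u, v} \<noteq> {x, y} \<Longrightarrow>
        path_image (g u v) \<inter> path_image (g x y) \<subseteq> f ` ({u, v} \<inter> {x, y})"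
    by simp_all
  define mid where "mid u v = (SOME m. m \<notin> h ` V \<and> R (h u) m \<and> R m (h v) \<and> {y. R m y} = {h u, h v})" for u v
  have mid: "mid u v \<notin> h ` V" "R (h u) (mid u v)" "R (mid u v) (h v)" "{y. R (mid u v) y} = {h u, h v}"
    if "E u v" "\<not> R (h u) (h v)" for u v
    using someI_ex[of "\<lambda>m. m \<notin> h ` V \<and> R (h u) m \<and> R m (h v) \<and> {y. R m y} = {h u, h v}"]
      edges[OF that(1)] that(2) unfolding mid_def by blast+
  define k where "k u v = (if R (h u) (h v) then g (h u) (h v) else g (h u) (mid u v) +++ g (mid u v) (h v))" for u v
  define P where "P u v = (if R (h u) (h v) then {(h u, h v)} else {(h u, mid u v), (mid u v, h v)})" for u v
  have P_edge: "R a b" if "(a, b) \<in> P u v" "E u v" for a b u v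
    using that mid[of u v] unfolding P_def by (auto split: if_splits)
  have P_image: "path_image (k u v) = (\<Union>(a, b)\<in>P u v. path_image (g a b))" if "E u v" for u v
    using mid[OF that] d(2) unfolding k_def P_def by (auto simp: path_image_join)
  have P_verts: "{a, b} \<inter> {a', b'} \<subseteq> h ` ({u, v} \<inter> {x, y})"
    if ab: "(a, b) \<in> P u v" "(a', b') \<in> P x y" and e: "E u v" "E x y" and ne: "{u, v} \<noteq> {x, y}"
    for a b a' b' u v x y
  proof -
    note V = verts[OF e(1)] verts[OF e(2)]
    have hV: "h s = h t \<longleftrightarrow> s = t" if "s \<in> V" "t \<in> V" for s t
      using h(1) that by (meson inj_on_eq_iff)
    have "mid u v \<noteq> mid x y" if "\<not> R (h u) (h v)" "\<not> R (h x) (h y)"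
    proof
      assume "mid u v = mid x y"
      then have "{h u, h v} = {h x, h y}" using mid(4)[OF e(1) that(1)] mid(4)[OF e(2) that(2)] by simp
      then show False using ne V hV by (auto simp: doubleton_eq_iff)
    qed
    moreover have "mid u v \<noteq> h s" "h s \<noteq> mid u v" if "\<not> R (h u) (h v)" "s \<in> V" for s
      using mid(1)[OF e(1) that(1)] that(2) by (metis imageI)+
    moreover have "mid x y \<noteq> h s" "h s \<noteq> mid x y" if "\<not> R (h x) (h y)" "s \<in> V" for s
      using mid(1)[OF e(2) that(1)] that(2) by (metis imageI)+
    ultimately show ?thesis
      using ab V hV unfolding P_def by (auto split: if_splits)
  qed
  show ?thesis
    unfolding planar_def
  proof (intro exI[of _ "f \<circ> h"] exI[of _ k] conjI allI impI)
    show "inj_on (f \<circ> h) V" using h d(1) by (meson comp_inj_on inj_on_subset)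
    fix u v assume e: "E u v"
    have "arc (k u v) \<and> pathstart (k u v) = f (h u) \<and> pathfinish (k u v) = f (h v)"
    proof (cases "R (h u) (h v)")
      case True then show ?thesis using d(2) by (simp add: k_def)
    next
      case False
      note m = mid[OF e False]
      have uv: "h u \<noteq> h v" using verts[OF e] h(1) by (simp add: inj_on_eq_iff)
      then have "{h u, mid u v} \<noteq> {mid u v, h v}" using m verts[OF e] by (auto simp: doubleton_eq_iff)
      then have "path_image (g (h u) (mid u v)) \<inter> path_image (g (mid u v) (h v)) \<subseteq> f ` ({h u, mid u v} \<inter> {mid u v, h v})"
        using d(4)[OF m(2,3)] by simp
      also have "\<dots> = {f (mid u v)}" using uv m(1) verts[OF e] by auto
      finally show ?thesis
        using False d(2)[OF m(2)] d(2)[OF m(3)] by (auto simp: k_def intro!: arc_join)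
    qed
    then show "arc (k u v)" "pathstart (k u v) = (f \<circ> h) u" "pathfinish (k u v) = (f \<circ> h) v" by auto
  next
    fix u v w assume *: "E u v \<and> w \<in> V \<and> w \<noteq> u \<and> w \<noteq> v"
    show "(f \<circ> h) w \<notin> path_image (k u v)"
    proof
      assume "(f \<circ> h) w \<in> path_image (k u v)"
      then obtain a b where ab: "(a, b) \<in> P u v" "f (h w) \<in> path_image (g a b)" using P_image * by auto
      then have "h w = a \<or> h w = b" using d(3)[of a b "h w"] P_edge * h(2) by blast
      moreover have "h w \<noteq> h u" "h w \<noteq> h v" using * verts[of u v] h(1) by (auto simp: inj_on_eq_iff)
      moreover have "h w \<noteq> mid u v" if "\<not> R (h u) (h v)" using mid(1)[of u v] * that by (metis imageI)
      ultimately show False using ab(1) unfolding P_def by (auto split: if_splits)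
    qed
  next
    fix u v x y assume *: "E u v \<and> E x y \<and> {u, v} \<noteq> {x, y}"
    show "path_image (k u v) \<inter> path_image (k x y) \<subseteq> (f \<circ> h) ` ({u, v} \<inter> {x, y})"
    proof
      fix z assume "z \<in> path_image (k u v) \<inter> path_image (k x y)"
      then obtain a b a' b' where ab: "(a, b) \<in> P u v" "z \<in> path_image (g a b)"
        "(a', b') \<in> P x y" "z \<in> path_image (g a' b')"
        using P_image * by auto
      have sub: "{a, b} \<inter> {a', b'} \<subseteq> h ` ({u, v} \<inter> {x, y})" using P_verts[OF ab(1,3)] * by blast
      \<comment> \<open>An arc used by both composites would give the two edges two common ends, but
        different edges share at most one.\<close>
      have "{a, b} \<noteq> {a', b'}"
      proof
        assume "{a, b} = {a', b'}"
        then have "a \<in> h ` ({u, v} \<inter> {x, y})" "b \<in> h ` ({u, v} \<inter> {x, y})" using sub by auto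
        then obtain s t where st: "s \<in> {u, v} \<inter> {x, y}" "t \<in> {u, v} \<inter> {x, y}" "a = h s" "b = h t"
          by (elim imageE)
        have "a \<noteq> b" using irrefl P_edge ab(1) * by blast
        then have "s \<noteq> t" using st by auto
        then show False using st * by auto
      qed
      then have "z \<in> f ` ({a, b} \<inter> {a', b'})" using d(4)[of a b a' b'] P_edge ab * by blast
      then show "z \<in> (f \<circ> h) ` ({u, v} \<inter> {x, y})" using sub by auto
    qed
  qed
qed

subsection \<open>Attaching ears\<close>

text \<open>New nodes are addressed by index, so crossings among new arcs become arithmetic. One
  form serves both pages: \<open>a\<close> will be \<open>x\<close> on one page and the shadow of
  \<open>x\<close> on the other.\<close>

definition insert_arcs :: "('b \<Rightarrow> 'b \<Rightarrow> bool) \<Rightarrow> (nat \<Rightarrow> 'b) \<Rightarrow> (nat \<Rightarrow> nat \<Rightarrow> bool) \<Rightarrow> nat set \<Rightarrow> 'b \<Rightarrow> 'b \<Rightarrow> 'b \<Rightarrow> bool"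
  where "insert_arcs T node L X a b c \<longleftrightarrow> T b c \<or>
    (\<exists>k l. L k l \<and> (b = node k \<and> c = node l \<or> b = node l \<and> c = node k)) \<or>
    (\<exists>k\<in>X. b = node k \<and> c = a \<or> b = a \<and> c = node k)"

lemma insert_arcs_sym: "(\<And>a b. T a b \<Longrightarrow> T b a) \<Longrightarrow> insert_arcs T node L X a b c \<Longrightarrow> insert_arcs T node L X a c b"
  unfolding insert_arcs_def by blast

text \<open>The new nodes sit immediately to the right of a node \<open>m\<close> whose only arc on the page goes to \<open>a\<close>,
  so their arcs to \<open>a\<close> run parallel to that arc.\<close>

lemma noncrossing_insert_arcs:
  fixes pos pos' :: "'b \<Rightarrow> real" and K :: nat
  assumes nc: "noncrossing pos T" and T_verts: "\<And>b c. T b c \<Longrightarrow> b \<in> N \<and> c \<in> N" and T_sym: "\<And>b c. T b c \<Longrightarrow> T c b"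
    and inj: "inj_on pos N" and m: "m \<in> N" "a \<in> N" "\<And>y. T m y \<longleftrightarrow> y = a"
    and pos': "\<And>y. y \<in> N \<Longrightarrow> pos' y = pos y"
    and gap: "\<And>y. y \<in> N \<Longrightarrow> pos y \<le> pos m \<or> pos m + \<epsilon> \<le> pos y"
    and new: "\<And>k. k < K \<Longrightarrow> pos m < pos' (node k) \<and> pos' (node k) < pos m + \<epsilon>"
    and mono: "\<And>k l. k < K \<Longrightarrow> l < K \<Longrightarrow> pos' (node k) < pos' (node l) \<longleftrightarrow> k < l"
    and L_bound: "\<And>k l. L k l \<Longrightarrow> k < l \<and> l < K"
    and L_nc: "\<And>k l k' l'. L k l \<Longrightarrow> L k' l' \<Longrightarrow> \<not> (k < k' \<and> k' < l \<and> l < l')"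
    and X_bound: "\<And>k. k \<in> X \<Longrightarrow> k < K" and X_exposed: "\<And>k i j. k \<in> X \<Longrightarrow> L i j \<Longrightarrow> \<not> (i < k \<and> k < j)"
  shows "noncrossing pos' (insert_arcs T node L X a)"
proof -
  have Tm: "T m a" "T a m" using m T_sym by auto
  have ncT: False if "T b c" "T d e" "pos b < pos d" "pos d < pos c" "pos c < pos e" for b c d e
    using nc that unfolding noncrossing_def by blast
  have eq_m: "b = m" if "b \<in> N" "pos b = pos m" for b using inj m(1) that by (meson inj_onD)
  have out: False if "y \<in> N" "k < K" "l < K" "pos' (node k) < pos' y" "pos' y < pos' (node l)" for y k l
    using gap[OF that(1)] new[OF that(2)] new[OF that(3)] pos'[OF that(1)] that by linarith
  have "False"
    if arcs: "insert_arcs T node L X a b c" "insert_arcs T node L X a d e"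
      and lt: "pos' b < pos' d" "pos' d < pos' c" "pos' c < pos' e" for b c d e
  proof -
    have cases: "T b c \<or> (\<exists>k l. L k l \<and> b = node k \<and> c = node l) \<or> (\<exists>k\<in>X. b = node k \<and> c = a \<or> b = a \<and> c = node k)"
      if "insert_arcs T node L X a b c" "pos' b < pos' c" for b c
    proof -
      have "\<not> (b = node l \<and> c = node k)" if "L k l" for k l
        using mono[of l k] L_bound[OF that] \<open>pos' b < pos' c\<close> by auto
      then show ?thesis using that(1) unfolding insert_arcs_def by blast
    qed
    have bc: "pos' b < pos' c" and de: "pos' d < pos' e" using lt by auto
    consider (T) "T b c" | (L) k l where "L k l" "b = node k" "c = node l"
      | (X) k where "k \<in> X" "b = node k" "c = a" | (X') k where "k \<in> X" "b = a" "c = node k"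
      using cases[OF arcs(1) bc] by blast
    note case_bc = this
    consider (T) "T d e" | (L) k l where "L k l" "d = node k" "e = node l"
      | (X) k where "k \<in> X" "d = node k" "e = a" | (X') k where "k \<in> X" "d = a" "e = node k"
      using cases[OF arcs(2) de] by blast
    note case_de = this
    show False
      using case_bc
    proof cases
      case 1: T
      then have N: "b \<in> N" "c \<in> N" using T_verts by auto
      show False using case_de
      proof cases
        case T
        then show ?thesis using ncT[of b c d e] 1 lt N T_verts pos' by auto
      next
        case (L k l)
        then show ?thesis using out[of c k l] N L_bound[of k l] lt by auto
      next
        case (X k)
        \<comment> \<open>No old node lies between \<open>m\<close> and \<open>node k\<close>, so
          replacing \<open>node k\<close> by \<open>m\<close> keeps the order. Moreover
          \<open>b\<close> is not \<open>m\<close>, whose only arc goes to \<open>a\<close>. Hence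
          \<open>T b c\<close> would already cross the arc from \<open>m\<close> to
          \<open>a\<close>; the remaining mixed cases are similar.\<close>
        have "pos b \<le> pos m" "pos m < pos c" "pos c < pos a"
          using gap[OF N(1)] gap[OF N(2)] new[of k] X_bound X lt pos' N m(2) by auto
        moreover have "b \<noteq> m" using 1 m(3) \<open>pos c < pos a\<close> by auto
        then have "pos b \<noteq> pos m" using eq_m[OF N(1)] by blast
        ultimately show ?thesis using ncT[of b c m a] 1 Tm by auto
      next
        case (X' k)
        have "pos c \<le> pos m" "pos b < pos a" "pos a < pos c"
          using gap[OF N(2)] new[of k] X_bound X' lt pos' N m(2) by auto
        moreover have "c \<noteq> m" using 1 m(3) T_sym[of b c] \<open>pos b < pos a\<close> by auto
        then have "pos c \<noteq> pos m" using eq_m[OF N(2)] by blast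
        ultimately show ?thesis using ncT[of b c a m] 1 Tm by auto
      qed
    next
      case 1: (L k l)
      then have kl: "k < K" "l < K" using L_bound[of k l] by auto
      show False using case_de
      proof cases
        case T
        then show ?thesis using out[of d k l] kl 1 lt T_verts by auto
      next
        case (L k' l')
        then have "k' < K" "l' < K" using L_bound[of k' l'] by auto
        then show ?thesis using L_nc[OF 1(1) L(1)] mono kl lt 1 L by auto
      next
        case (X k')
        then have "k' < K" using X_bound by auto
        then show ?thesis using X_exposed[OF X(1) 1(1)] mono kl lt 1 X by auto
      next
        case (X' k')
        then show ?thesis using out[of a k l] kl 1 lt m(2) by auto
      qed
    next
      case 1: (X k)
      then have k: "k < K" using X_bound by auto
      show False using case_de
      proof cases
        case T
        then have N: "d \<in> N" "e \<in> N" using T_verts by auto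
        have "pos m < pos d" "pos d < pos a" "pos a < pos e"
          using new[OF k] lt 1 pos' N m(2) by auto
        then show ?thesis using ncT[of m a d e] T Tm by blast
      next
        case (L k' l')
        then show ?thesis using out[of a k' l'] L_bound[of k' l'] m(2) 1 lt by auto
      qed (use 1 lt in auto)
    next
      case 1: (X' k)
      then have k: "k < K" using X_bound by auto
      show False using case_de
      proof cases
        case T
        then have N: "d \<in> N" "e \<in> N" using T_verts by auto
        have "pos a < pos d" "pos d \<le> pos m" "pos m < pos e" "pos a < pos e"
          using gap[OF N(1)] new[OF k] lt 1 pos' N m(2) by auto
        moreover have "d \<noteq> m" using T m(3) \<open>pos a < pos e\<close> by auto
        then have "pos d \<noteq> pos m" using eq_m[OF N(1)] by blast
        ultimately show ?thesis using ncT[of a m d e] T Tm by auto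
      next
        case (L k' l')
        then have "k' < K" "l' < K" using L_bound[of k' l'] by auto
        then show ?thesis using X_exposed[OF 1(1) L(1)] mono k lt 1 L by auto
      qed (use 1 lt in auto)
    qed
  qed
  then show ?thesis unfolding noncrossing_def by blast
qed

text \<open>Arcs among the new nodes of an ear \<open>x, u\<^sub>0, \<dots>, u\<^sub>n\<^sub>-\<^sub>1, x\<close>; the code \<open>4 * j + i\<close> stands for
  the node \<open>(u\<^sub>j, i)\<close> of a shadow book. The shadow of \<open>u\<^sub>j\<close> has its arcs on the top page for even \<open>j\<close> and
  on the bottom page for odd \<open>j\<close>. The spare node of \<open>u\<^sub>n\<^sub>-\<^sub>1\<close> leads the edge from \<open>u\<^sub>n\<^sub>-\<^sub>1\<close> to \<open>x\<close> below
  the shadow of \<open>u\<^sub>n\<^sub>-\<^sub>1\<close>, which is free because \<open>n\<close> is odd.\<close>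

definition ear_chain :: "bool \<Rightarrow> nat \<Rightarrow> nat \<Rightarrow> nat \<Rightarrow> bool" where
  "ear_chain par n k l \<longleftrightarrow> (\<exists>j<n. even j = par \<and>
     (0 < j \<and> k + 4 = 4 * j \<and> (l = 4 * j \<or> l = 4 * j + 2) \<or> Suc j < n \<and> k = 4 * j + 2 \<and> l = 4 * j + 4))"

definition ear_top :: "nat \<Rightarrow> nat \<Rightarrow> nat \<Rightarrow> bool" where
  "ear_top n k l \<longleftrightarrow> ear_chain True n k l \<or> (\<exists>j<n. k = 4 * j \<and> l = 4 * j + 1)"

text \<open>The middle node \<open>4 * j + 1\<close> has its arc to the vertex on top and its arc to
  the shadow here. The last disjunct joins \<open>u\<^sub>n\<^sub>-\<^sub>1\<close> to its spare
  node, written additively to avoid truncated subtraction.\<close>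

definition ear_bottom :: "nat \<Rightarrow> nat \<Rightarrow> nat \<Rightarrow> bool" where
  "ear_bottom n k l \<longleftrightarrow> ear_chain False n k l \<or> (\<exists>j<n. k = 4 * j + 1 \<and> l = 4 * j + 2) \<or>
     (k + 4 = 4 * n \<and> l + 1 = 4 * n)"

lemma ear_top_bounds: "ear_top n k l \<Longrightarrow> k < l \<and> l < 4 * n"
  unfolding ear_top_def ear_chain_def by auto

lemma ear_bottom_bounds: "ear_bottom n k l \<Longrightarrow> k < l \<and> l < 4 * n"
  unfolding ear_bottom_def ear_chain_def by auto

lemma ear_chain_span:
  assumes "ear_chain par n k l"
  obtains j where "j < n" "even j = par" "4 * j \<le> k + 4" "l \<le> 4 * j + 4"
    "0 < j \<and> k + 4 = 4 * j \<and> (l = 4 * j \<or> l = 4 * j + 2) \<or> k = 4 * j + 2 \<and> l = 4 * j + 4 \<and> Suc j < n"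
proof -
  obtain j where j: "j < n" "even j = par"
    "0 < j \<and> k + 4 = 4 * j \<and> (l = 4 * j \<or> l = 4 * j + 2) \<or> Suc j < n \<and> k = 4 * j + 2 \<and> l = 4 * j + 4"
    using assms unfolding ear_chain_def by blast
  then show thesis by (intro that[of j]) auto
qed

text \<open>Arcs with parameter \<open>j\<close> stay between \<open>4 * j - 4\<close> and
  \<open>4 * j + 4\<close>. On one page different parameters are at least 2 apart, so these ranges
  share at most an end, and the arcs of a single parameter do not cross.\<close>

lemma ear_chain_noncrossing:
  assumes "ear_chain par n k l" "ear_chain par n k' l'"
  shows "\<not> (k < k' \<and> k' < l \<and> l < l')"
proof -
  obtain j where j: "even j = par" "4 * j \<le> k + 4" "l \<le> 4 * j + 4"
    "0 < j \<and> k + 4 = 4 * j \<and> (l = 4 * j \<or> l = 4 * j + 2) \<or> k = 4 * j + 2 \<and> l = 4 * j + 4"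
    using ear_chain_span[OF assms(1)] by metis
  obtain i where i: "even i = par" "4 * i \<le> k' + 4" "l' \<le> 4 * i + 4"
    "0 < i \<and> k' + 4 = 4 * i \<and> (l' = 4 * i \<or> l' = 4 * i + 2) \<or> k' = 4 * i + 2 \<and> l' = 4 * i + 4"
    using ear_chain_span[OF assms(2)] by metis
  have "i = j \<or> i + 2 \<le> j \<or> j + 2 \<le> i"
  proof -
    have "i \<noteq> Suc j" "j \<noteq> Suc i" using i(1) j(1) by auto
    then show ?thesis by linarith
  qed
  then show ?thesis using i(4) j(4) by (elim disjE conjE; linarith)
qed

lemma ear_top_noncrossing:
  assumes "ear_top n k l" "ear_top n k' l'"
  shows "\<not> (k < k' \<and> k' < l \<and> l < l')"
proof -
  have "l \<noteq> k + 1 \<Longrightarrow> ear_chain True n k l" "l' \<noteq> k' + 1 \<Longrightarrow> ear_chain True n k' l'"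
    using assms unfolding ear_top_def by auto
  then show ?thesis
    using ear_chain_noncrossing[of True n k l k' l'] by (cases "l = k + 1"; cases "l' = k' + 1") auto
qed

text \<open>For odd \<open>n\<close> the last index \<open>n - 1\<close> is even, so the bottom
  chain stops at \<open>4 * n - 4\<close> at the latest, where the arc to the spare node
  starts.\<close>

lemma ear_bottom_noncrossing:
  assumes "odd n" "ear_bottom n k l" "ear_bottom n k' l'"
  shows "\<not> (k < k' \<and> k' < l \<and> l < l')"
proof -
  have cases: "l = k + 1 \<or> (k + 4 = 4 * n \<and> l + 1 = 4 * n) \<or> ear_chain False n k l \<and> l + 4 \<le> 4 * n"
    if kl: "ear_bottom n k l" for k l
  proof (cases "ear_chain False n k l")
    case True
    then obtain j where j: "j < n" "\<not> even j" "l \<le> 4 * j + 4" by (rule ear_chain_span) auto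
    then have "Suc j < n" using assms(1) by (metis Suc_lessI even_Suc)
    then show ?thesis using True j by linarith
  next
    case False
    then show ?thesis using kl unfolding ear_bottom_def by auto
  qed
  show ?thesis
    using cases[OF assms(2)] cases[OF assms(3)]
  proof (elim disjE conjE)
    assume "ear_chain False n k l" "ear_chain False n k' l'"
    then show ?thesis by (rule ear_chain_noncrossing)
  qed (use ear_bottom_bounds[OF assms(3)] in linarith)+
qed

text \<open>A top arc passing over code 2 would be a chain arc from \<open>u\<^sub>0\<close> to
  \<open>u\<^sub>1\<close> or its shadow, but these have parameter 1 and lie on the bottom page. At
  the other end, no top arc goes beyond \<open>4 * n - 2\<close>.\<close>

lemma ear_top_exposed:
  assumes "odd n" "k \<in> {0, 2, 4 * n - 2, 4 * n - 1}" "ear_top n i j"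
  shows "\<not> (i < k \<and> k < j)"
proof (cases "ear_chain True n i j")
  case True
  then obtain t where t: "t < n" "even t" "4 * t \<le> i + 4" "j \<le> 4 * t + 4"
    "0 < t \<and> i + 4 = 4 * t \<and> (j = 4 * t \<or> j = 4 * t + 2) \<or> i = 4 * t + 2 \<and> j = 4 * t + 4 \<and> Suc t < n"
    by (rule ear_chain_span) auto
  have "t \<noteq> Suc 0" using t(2) by auto
  then have "t = 0 \<or> t \<ge> 2" by linarith
  moreover have "k = 0 \<or> k = 2 \<or> k + 2 = 4 * n \<or> k + 1 = 4 * n" using assms(2) t(1) by auto
  ultimately show ?thesis using t(1,5) by (elim disjE conjE; linarith)
next
  case False
  then show ?thesis using assms unfolding ear_top_def by auto
qed

lemma ear_bottom_exposed:
  assumes "odd n" "k \<in> {0, 4 * n - 4}" "ear_bottom n i j"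
  shows "\<not> (i < k \<and> k < j)"
proof (cases "ear_chain False n i j")
  case True
  then obtain t where t: "t < n" "odd t" "j \<le> 4 * t + 4" by (rule ear_chain_span) auto
  then have "Suc t < n" using assms(1) by (metis Suc_lessI even_Suc)
  then show ?thesis using t assms(2) by auto
next
  case False
  then show ?thesis using assms unfolding ear_bottom_def by auto
qed

text \<open>The order of the arguments records which page leads from the middle node to
  \<open>v\<close> and which to its shadow. There must be no other arcs at the middle node, so that
  the room beside it stays free.\<close>

definition splits_shadow_edge :: "('a \<times> nat \<Rightarrow> 'a \<times> nat \<Rightarrow> bool) \<Rightarrow> ('a \<times> nat \<Rightarrow> 'a \<times> nat \<Rightarrow> bool) \<Rightarrow> 'a \<Rightarrow> bool" where
  "splits_shadow_edge T B v \<longleftrightarrow> (\<forall>y. T (v, 1) y \<longleftrightarrow> y = (v, 0)) \<and> (\<forall>y. B (v, 1) y \<longleftrightarrow> y = (v, 2))"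

lemma insert_arcs_old:
  assumes "b \<notin> node ` {..<K}" "b \<noteq> a" "\<And>k l. L k l \<Longrightarrow> k < K \<and> l < K" "X \<subseteq> {..<K}"
  shows "insert_arcs T node L X a b y \<longleftrightarrow> T b y"
  using assms unfolding insert_arcs_def by blast

lemma insert_arcs_new:
  assumes "\<And>c. \<not> T (node k) c" "inj_on node {..<K}" "k < K" "a \<notin> node ` {..<K}"
    "\<And>k l. L k l \<Longrightarrow> k < K \<and> l < K" "X \<subseteq> {..<K}"
  shows "insert_arcs T node L X a (node k) y \<longleftrightarrow> (\<exists>l. (L k l \<or> L l k) \<and> y = node l) \<or> k \<in> X \<and> y = a"
proof -
  have eq: "node k = node l \<longleftrightarrow> l = k" if "l < K" for l
    using assms(2,3) that by (auto dest: inj_onD)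
  have "node k \<noteq> a" using assms(3,4) by auto
  then show ?thesis using assms(1,5,6) eq unfolding insert_arcs_def by (auto simp: subset_iff) blast+
qed

text \<open>A two-page book drawing of a subdivision of the great shadow, on nodes \<open>(v, i)\<close>: \<open>(v, 0)\<close> is \<open>v\<close>, \<open>(v, 2)\<close> is
  its shadow, \<open>(v, 1)\<close> subdivides the edge between them and has one arc on each page, and \<open>(v, 3)\<close> is a spare
  node that may subdivide an edge of the graph.\<close>

locale shadow_book =
  fixes V :: "'a set" and E :: "'a \<Rightarrow> 'a \<Rightarrow> bool" and pos :: "'a \<times> nat \<Rightarrow> real"
    and T B :: "'a \<times> nat \<Rightarrow> 'a \<times> nat \<Rightarrow> bool"
  assumes inj_pos: "inj_on pos (V \<times> {..<4})"
    and arc_nodes: "T a b \<or> B a b \<Longrightarrow> a \<in> V \<times> {..<4} \<and> b \<in> V \<times> {..<4} \<and> a \<noteq> b"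
    and T_sym: "T a b \<Longrightarrow> T b a" and B_sym: "B a b \<Longrightarrow> B b a"
    and nc_T: "noncrossing pos T" and nc_B: "noncrossing pos B"
    and splits: "v \<in> V \<Longrightarrow> splits_shadow_edge T B v \<or> splits_shadow_edge B T v"
    and shadow_edge: "u \<in> V \<Longrightarrow> v \<in> V \<Longrightarrow> E u v \<Longrightarrow> T (u, 0) (v, 2) \<or> B (u, 0) (v, 2)"
    and edge: "u \<in> V \<Longrightarrow> v \<in> V \<Longrightarrow> E u v \<Longrightarrow> T (u, 0) (v, 0) \<or> B (u, 0) (v, 0) \<or>
        (\<exists>w\<in>V. {y. T (w, 3) y \<or> B (w, 3) y} = {(u, 0), (v, 0)})"
begin

text \<open>The assumption \<open>splits\<close> leaves open which page leads to the vertex itself;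
  exchanging the pages allows \<open>add_ear\<close> to fix one case.\<close>

lemma swap: "shadow_book V E pos B T"
proof
  fix u v assume "u \<in> V" "v \<in> V" "E u v"
  then show "B (u, 0) (v, 0) \<or> T (u, 0) (v, 0) \<or> (\<exists>w\<in>V. {y. B (w, 3) y \<or> T (w, 3) y} = {(u, 0), (v, 0)})"
    using edge[of u v] by (simp only: disj_commute[of "B _ _" "T _ _"] disj_assoc[symmetric])
qed (use inj_pos arc_nodes T_sym B_sym nc_T nc_B splits shadow_edge in blast)+

lemma shadow_planar:
  assumes graph: "simple_graph V E"
  shows "planar (shadow_verts V) (shadow_adj V E)"
proof -
  define h :: "'a + 'a \<Rightarrow> 'a \<times> nat" where "h = case_sum (\<lambda>v. (v, 0)) (\<lambda>v. (v, 2))"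
  have h_simps [simp]: "h (Inl v) = (v, 0)" "h (Inr v) = (v, 2)" for v by (simp_all add: h_def)
  define R where "R a b \<longleftrightarrow> T a b \<or> B a b" for a b
  have E: "u \<in> V" "v \<in> V" "u \<noteq> v" "E v u" if "E u v" for u v
    using graph that unfolding simple_graph_def by blast+
  have sym: "R a b \<Longrightarrow> R b a" for a b using T_sym B_sym unfolding R_def by blast
  have split_nbrs: "{y. R (v, 1) y} = {(v, 0), (v, 2)}" if "v \<in> V" for v
    using splits[OF that] unfolding splits_shadow_edge_def R_def by auto
  have edge_R: "R (u, 0) (v, 0) \<or> (\<exists>w\<in>V. {y. R (w, 3) y} = {(u, 0), (v, 0)})" if "E u v" for u v
    using edge[of u v] E[OF that] that unfolding R_def by simp
  have "planar (V \<times> {..<4}) R"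
    unfolding R_def[abs_def] by (rule book_planar[OF inj_pos arc_nodes T_sym B_sym nc_T nc_B])
  then show ?thesis
  proof (rule planar_suppress_vertices[where h = h])
    show "R a b \<Longrightarrow> a \<noteq> b" for a b using arc_nodes unfolding R_def by blast
    show "inj_on h (shadow_verts V)" by (auto simp: inj_on_def shadow_verts_def)
    show "h ` shadow_verts V \<subseteq> V \<times> {..<4}" by (auto simp: shadow_verts_def)
    fix p q assume pq: "shadow_adj V E p q"
    show "p \<in> shadow_verts V \<and> q \<in> shadow_verts V \<and> p \<noteq> q"
      using pq E by (cases p; cases q) (auto simp: shadow_verts_def)
    have middle: "\<exists>m. m \<notin> h ` shadow_verts V \<and> R (h p) m \<and> R m (h q) \<and> {y. R m y} = {h p, h q}"
      if "{y. R (w, i) y} = {h p, h q}" "i = 1 \<or> i = 3" for w i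
    proof (intro exI[of _ "(w, i)"] conjI)
      show "(w, i) \<notin> h ` shadow_verts V" using that(2) by (auto simp: shadow_verts_def)
      show "R (w, i) (h q)" "R (h p) (w, i)" using that(1) sym by blast+
    qed (rule that(1))
    show "R (h p) (h q) \<or>
      (\<exists>m. m \<notin> h ` shadow_verts V \<and> R (h p) m \<and> R m (h q) \<and> {y. R m y} = {h p, h q})"
    proof (cases "\<exists>v\<in>V. {p, q} = {Inl v, Inr v}")
      case True
      then obtain v where "v \<in> V" "{h p, h q} = {(v, 0), (v, 2)}" by (auto simp: doubleton_eq_iff)
      then show ?thesis using middle[of v 1] split_nbrs by simp
    next
      case False
      show ?thesis
      proof (cases p; cases q)
        fix u v assume "p = Inl u" "q = Inl v"
        then show ?thesis using edge_R[of u v] middle[of _ 3] pq E[of u v] by auto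
      next
        fix u v assume "p = Inl u" "q = Inr v"
        then show ?thesis using shadow_edge[of u v, folded R_def] pq E[of u v] False by auto
      next
        fix u v assume "p = Inr u" "q = Inl v"
        then show ?thesis using shadow_edge[of v u, folded R_def] sym pq E[of u v] False by auto
      qed (use pq in auto)
    qed
  qed
qed

text \<open>Length 1 is a pendant edge, walked as \<open>x\<close>, \<open>u\<close>,
  \<open>x\<close>; a larger odd length closes an even cycle. All new nodes go into the gap to the
  right of the middle node of \<open>x\<close>, in the order of their codes.\<close>

lemma add_ear:
  assumes fin: "finite V" and x: "x \<in> V" and spl: "splits_shadow_edge T B x"
    and us: "distinct us" "set us \<inter> V = {}" "odd (length us)"
    and new_edges: "\<And>a b. E a b \<Longrightarrow> a \<in> V \<union> set us \<Longrightarrow> b \<in> V \<union> set us \<Longrightarrow> \<not> (a \<in> V \<and> b \<in> V) \<Longrightarrow>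
      {a, b} \<in> path_edges (x # us @ [x])"
  shows "\<exists>pos' T' B'. shadow_book (V \<union> set us) E pos' T' B'"
proof -
  define n where "n = length us"
  have n: "n > 0" "odd n" using us(3) unfolding n_def by (auto intro: odd_pos)
  define N where "N = V \<times> {..<4::nat}"
  define node where "node k = (us ! (k div 4), k mod 4)" for k
  have T_N: "T a b \<Longrightarrow> a \<in> N \<and> b \<in> N \<and> a \<noteq> b" and B_N: "B a b \<Longrightarrow> a \<in> N \<and> b \<in> N \<and> a \<noteq> b" for a b
    using arc_nodes unfolding N_def by blast+
  note inj_N = inj_pos[folded N_def]
  have div_lt: "k div 4 < n" if "k < 4 * n" for k
    using that by (simp add: less_mult_imp_div_less mult.commute)
  have node_fst: "fst (node k) \<in> set us" if "k < 4 * n" for k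
    using div_lt[OF that] unfolding node_def n_def by simp
  have node_N: "node k \<notin> N" if "k < 4 * n" for k
    using node_fst[OF that] us(2) unfolding N_def by (cases "node k") auto
  have node_inj: "inj_on node {..<4 * n}"
  proof (rule inj_onI)
    fix k l assume kl: "k \<in> {..<4 * n}" "l \<in> {..<4 * n}" "node k = node l"
    then have "k div 4 = l div 4" "k mod 4 = l mod 4"
      using us(1) div_lt[of k] div_lt[of l] unfolding node_def n_def by (auto simp: nth_eq_iff_index_eq)
    then show "k = l" by (metis mult_div_mod_eq)
  qed
  have node_code: "node (4 * j + i) = (us ! j, i)" if "i < 4" for i j
    using that unfolding node_def by simp
  have node_code0: "node (4 * j) = (us ! j, 0)" for j using node_code[of 0 j] by simp
  define p where "p = pos (x, 1)"
  have xN: "(x, 0) \<in> N" "(x, 1) \<in> N" "(x, 2) \<in> N" using x unfolding N_def by auto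
  obtain \<epsilon> where eps: "\<epsilon> > 0" and gap: "\<And>y. y \<in> N \<Longrightarrow> pos y \<le> p \<or> p + \<epsilon> \<le> pos y"
  proof -
    define D where "D = (\<lambda>y. pos y - p) ` {y \<in> N. pos y > p}"
    have fD: "finite D" using fin unfolding D_def N_def by simp
    \<comment> \<open>The 1 keeps the minimum defined when no node lies to the right of
      \<open>p\<close>.\<close>
    define e where "e = Min (insert 1 D)"
    have "e > 0" unfolding e_def using fD by (subst Min_gr_iff) (auto simp: D_def)
    moreover have "pos y \<le> p \<or> p + e \<le> pos y" if "y \<in> N" for y
    proof (cases "pos y \<le> p")
      case False
      then have "pos y - p \<in> D" using that unfolding D_def by auto
      then have "e \<le> pos y - p" unfolding e_def using fD by (intro Min_le) auto
      then show ?thesis by auto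
    qed auto
    ultimately show thesis using that by blast
  qed
  define code where "code = inv_into {..<4 * n} node"
  \<comment> \<open>Codes run from 0 to \<open>4 * n - 1\<close>; adding 1 and dividing by
    \<open>4 * n + 1\<close> spreads them strictly inside the gap.\<close>
  define pos' where "pos' y = (if y \<in> N then pos y else p + \<epsilon> * ((real (code y) + 1) / (4 * real n + 1)))" for y
  have pos'_old: "pos' y = pos y" if "y \<in> N" for y using that unfolding pos'_def by simp
  have pos'_new: "pos' (node k) = p + \<epsilon> * ((real k + 1) / (4 * real n + 1))" if "k < 4 * n" for k
    using that node_N[OF that] node_inj unfolding pos'_def code_def by simp
  have pos'_gap: "p < pos' (node k) \<and> pos' (node k) < p + \<epsilon>" if "k < 4 * n" for k
  proof -
    have "0 < (real k + 1) / (4 * real n + 1)" "(real k + 1) / (4 * real n + 1) < 1"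
      using that by (simp_all add: divide_simps)
    then show ?thesis
      using eps mult_strict_left_mono[of "(real k + 1) / (4 * real n + 1)" 1 \<epsilon>] unfolding pos'_new[OF that] by simp
  qed
  have pos'_mono: "pos' (node k) < pos' (node l) \<longleftrightarrow> k < l" if "k < 4 * n" "l < 4 * n" for k l
    using that eps by (simp add: pos'_new divide_less_cancel)
  \<comment> \<open>On top, \<open>x\<close> is joined to \<open>u\<^sub>0\<close>, to the shadows
    of \<open>u\<^sub>0\<close> and \<open>u\<^sub>n\<^sub>-\<^sub>1\<close>, and to the spare node
    of \<open>u\<^sub>n\<^sub>-\<^sub>1\<close>. Below, the shadow of \<open>x\<close> is joined to
    \<open>u\<^sub>0\<close> and \<open>u\<^sub>n\<^sub>-\<^sub>1\<close>.\<close>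
  define XT where "XT = {0, 2, 4 * n - 2, 4 * n - 1}"
  define XB where "XB = {0, 4 * n - 4}"
  have XT: "XT \<subseteq> {..<4 * n}" and XB: "XB \<subseteq> {..<4 * n}" using n unfolding XT_def XB_def by auto
  define T' where "T' = insert_arcs T node (ear_top n) XT (x, 0)"
  define B' where "B' = insert_arcs B node (ear_bottom n) XB (x, 2)"
  have LT: "k < 4 * n \<and> l < 4 * n" if "ear_top n k l" for k l using ear_top_bounds[OF that] by auto
  have LB: "k < 4 * n \<and> l < 4 * n" if "ear_bottom n k l" for k l using ear_bottom_bounds[OF that] by auto
  have not_node: "y \<notin> node ` {..<4 * n}" if "y \<in> N" for y using that node_N by auto
  have T'_old: "T' y z \<longleftrightarrow> T y z" if "y \<in> N" "y \<noteq> (x, 0)" for y z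
    unfolding T'_def using not_node[OF that(1)] that(2) LT XT by (rule insert_arcs_old)
  have B'_old: "B' y z \<longleftrightarrow> B y z" if "y \<in> N" "y \<noteq> (x, 2)" for y z
    unfolding B'_def using not_node[OF that(1)] that(2) LB XB by (rule insert_arcs_old)
  have T'_new: "T' (node k) y \<longleftrightarrow> (\<exists>l. (ear_top n k l \<or> ear_top n l k) \<and> y = node l) \<or> k \<in> XT \<and> y = (x, 0)"
    if "k < 4 * n" for k y
    unfolding T'_def using _ node_inj that not_node[OF xN(1)] LT XT
    by (rule insert_arcs_new) (use T_N node_N[OF that] in blast)
  have B'_new: "B' (node k) y \<longleftrightarrow> (\<exists>l. (ear_bottom n k l \<or> ear_bottom n l k) \<and> y = node l) \<or> k \<in> XB \<and> y = (x, 2)"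
    if "k < 4 * n" for k y
    unfolding B'_def using _ node_inj that not_node[OF xN(3)] LB XB
    by (rule insert_arcs_new) (use B_N node_N[OF that] in blast)
  have sym: "T' y z \<Longrightarrow> T' z y" "B' y z \<Longrightarrow> B' z y" for y z
    unfolding T'_def B'_def using insert_arcs_sym[of T] insert_arcs_sym[of B] T_sym B_sym by blast+
  have mono: "T y z \<Longrightarrow> T' y z" "B y z \<Longrightarrow> B' y z" for y z
    unfolding T'_def B'_def insert_arcs_def by blast+
  have nodes: "(V \<union> set us) \<times> {..<4} = N \<union> node ` {..<4 * n}"
  proof -
    have "\<exists>k<4 * n. (u, i) = node k" if ui: "u \<in> set us" "i < 4" for u i
    proof -
      obtain j where "j < n" "u = us ! j" using ui(1) unfolding n_def by (auto simp: in_set_conv_nth)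
      then show ?thesis using ui(2) by (intro exI[of _ "4 * j + i"]) (auto simp: node_code)
    qed
    then have "set us \<times> {..<4} \<subseteq> node ` {..<4 * n}" by auto
    moreover have "node ` {..<4 * n} \<subseteq> set us \<times> {..<4}"
      using node_fst by (auto simp: node_def)
    ultimately show ?thesis unfolding N_def by auto
  qed
  have inj': "inj_on pos' ((V \<union> set us) \<times> {..<4})"
    unfolding nodes
  proof (rule inj_on_Un[THEN iffD2], intro conjI)
    show "inj_on pos' N" using inj_N pos'_old by (simp add: inj_on_def)
    show "inj_on pos' (node ` {..<4 * n})"
      using pos'_mono by (auto simp: inj_on_def) (metis less_irrefl linorder_neqE_nat)
    show "pos' ` (N - node ` {..<4 * n}) \<inter> pos' ` (node ` {..<4 * n} - N) = {}"
    proof -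
      have "pos' y \<noteq> pos' (node k)" if "y \<in> N" "k < 4 * n" for y k
        using gap[OF that(1)] pos'_gap[OF that(2)] pos'_old[OF that(1)] by auto
      then show ?thesis by auto
    qed
  qed
  have verts: "y \<in> (V \<union> set us) \<times> {..<4} \<and> z \<in> (V \<union> set us) \<times> {..<4} \<and> y \<noteq> z" if "T' y z \<or> B' y z" for y z
  proof -
    have node_ne: "node k \<noteq> node l" if "k < l" "l < 4 * n" for k l
      using that node_inj by (auto dest: inj_onD)
    have X_ne: "node k \<noteq> (x, i)" "(x, i) \<noteq> node k" if "k \<in> XT \<or> k \<in> XB" for k i
      using node_fst[of k] that XT XB x us(2) by (cases "node k"; auto)+
    have "y \<in> N \<union> node ` {..<4 * n} \<and> z \<in> N \<union> node ` {..<4 * n} \<and> y \<noteq> z" if "T' y z"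
      using that unfolding T'_def insert_arcs_def
    proof (elim disjE exE bexE conjE)
      fix k l assume "ear_top n k l" "y = node k" "z = node l"
      then show ?thesis using ear_top_bounds[of n k l] node_ne[of k l] by auto
    next
      fix k l assume "ear_top n k l" "y = node l" "z = node k"
      then show ?thesis using ear_top_bounds[of n k l] node_ne[of k l] by auto
    qed (use T_N XT xN X_ne in \<open>auto simp: subset_iff\<close>)
    moreover have "y \<in> N \<union> node ` {..<4 * n} \<and> z \<in> N \<union> node ` {..<4 * n} \<and> y \<noteq> z" if "B' y z"
      using that unfolding B'_def insert_arcs_def
    proof (elim disjE exE bexE conjE)
      fix k l assume "ear_bottom n k l" "y = node k" "z = node l"
      then show ?thesis using ear_bottom_bounds[of n k l] node_ne[of k l] by auto
    next
      fix k l assume "ear_bottom n k l" "y = node l" "z = node k"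
      then show ?thesis using ear_bottom_bounds[of n k l] node_ne[of k l] by auto
    qed (use B_N XB xN X_ne in \<open>auto simp: subset_iff\<close>)
    ultimately show ?thesis using that unfolding nodes by blast
  qed
  have nc_T': "noncrossing pos' T'"
    unfolding T'_def
  proof (rule noncrossing_insert_arcs[where m = "(x, 1)" and N = N and K = "4 * n" and \<epsilon> = \<epsilon>])
    show "T (x, 1) y \<longleftrightarrow> y = (x, 0)" for y using spl unfolding splits_shadow_edge_def by blast
    show "\<not> (k < k' \<and> k' < l \<and> l < l')" if "ear_top n k l" "ear_top n k' l'" for k l k' l'
      using ear_top_noncrossing[OF that] .
    show "\<not> (i < k \<and> k < j)" if "k \<in> XT" "ear_top n i j" for k i j
      using ear_top_exposed[OF n(2) _ that(2)] that(1) unfolding XT_def by blast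
    show "b \<in> N \<and> c \<in> N" if "T b c" for b c using T_N[OF that] by blast
    show "pos y \<le> pos (x, 1) \<or> pos (x, 1) + \<epsilon> \<le> pos y" if "y \<in> N" for y using gap[OF that] unfolding p_def .
    show "pos (x, 1) < pos' (node k) \<and> pos' (node k) < pos (x, 1) + \<epsilon>" if "k < 4 * n" for k
      using pos'_gap[OF that] unfolding p_def .
    show "k < 4 * n" if "k \<in> XT" for k using that XT by blast
  qed (rule nc_T T_sym inj_N xN pos'_old pos'_mono ear_top_bounds; assumption?)+
  have nc_B': "noncrossing pos' B'"
    unfolding B'_def
  proof (rule noncrossing_insert_arcs[where m = "(x, 1)" and N = N and K = "4 * n" and \<epsilon> = \<epsilon>])
    show "B (x, 1) y \<longleftrightarrow> y = (x, 2)" for y using spl unfolding splits_shadow_edge_def by blast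
    show "\<not> (k < k' \<and> k' < l \<and> l < l')" if "ear_bottom n k l" "ear_bottom n k' l'" for k l k' l'
      using ear_bottom_noncrossing[OF n(2) that] .
    show "\<not> (i < k \<and> k < j)" if "k \<in> XB" "ear_bottom n i j" for k i j
      using ear_bottom_exposed[OF n(2) _ that(2)] that(1) unfolding XB_def by blast
    show "b \<in> N \<and> c \<in> N" if "B b c" for b c using B_N[OF that] by blast
    show "pos y \<le> pos (x, 1) \<or> pos (x, 1) + \<epsilon> \<le> pos y" if "y \<in> N" for y using gap[OF that] unfolding p_def .
    show "pos (x, 1) < pos' (node k) \<and> pos' (node k) < pos (x, 1) + \<epsilon>" if "k < 4 * n" for k
      using pos'_gap[OF that] unfolding p_def .
    show "k < 4 * n" if "k \<in> XB" for k using that XB by blast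
  qed (rule nc_B B_sym inj_N xN pos'_old pos'_mono ear_bottom_bounds; assumption?)+
  have split': "splits_shadow_edge T' B' v \<or> splits_shadow_edge B' T' v" if v: "v \<in> V \<union> set us" for v
  proof (cases "v \<in> V")
    case True
    then have "(v, 1) \<in> N" unfolding N_def by simp
    then show ?thesis using splits[OF True] T'_old[of "(v, 1)"] B'_old[of "(v, 1)"]
      unfolding splits_shadow_edge_def by simp
  next
    case False
    then obtain j where j: "j < n" "v = us ! j" using v unfolding n_def by (auto simp: in_set_conv_nth)
    have top: "ear_top n (4 * j + 1) l \<or> ear_top n l (4 * j + 1) \<longleftrightarrow> l = 4 * j" for l
      using j(1) unfolding ear_top_def ear_chain_def by (auto; presburger)
    have bottom: "ear_bottom n (4 * j + 1) l \<or> ear_bottom n l (4 * j + 1) \<longleftrightarrow> l = 4 * j + 2" for l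
      using j(1) unfolding ear_bottom_def ear_chain_def by (auto; presburger)
    have "4 * j + 1 \<notin> XT" "4 * j + 1 \<notin> XB" unfolding XT_def XB_def using n by (auto; presburger)+
    then have "T' (v, 1) y \<longleftrightarrow> y = (v, 0)" "B' (v, 1) y \<longleftrightarrow> y = (v, 2)" for y
      using T'_new[of "4 * j + 1" y] B'_new[of "4 * j + 1" y] j top bottom
        node_code[of 1 j] node_code[of 2 j] node_code0[of j] by auto
    then show ?thesis unfolding splits_shadow_edge_def by blast
  qed
  have consecutive: "(T' (us ! j, 0) (us ! Suc j, i) \<or> B' (us ! j, 0) (us ! Suc j, i)) \<and>
      (T' (us ! j, 2) (us ! Suc j, 0) \<or> B' (us ! j, 2) (us ! Suc j, 0))"
    if j: "Suc j < n" and i: "i = 0 \<or> i = 2" for i j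
  proof -
    have "ear_chain (even (Suc j)) n (4 * j) (4 * Suc j + i)" "ear_chain (even j) n (4 * j + 2) (4 * Suc j)"
      using j i unfolding ear_chain_def by (auto intro: exI[of _ "Suc j"] exI[of _ j])
    then have "ear_top n (4 * j) (4 * Suc j + i) \<or> ear_bottom n (4 * j) (4 * Suc j + i)"
      "ear_top n (4 * j + 2) (4 * Suc j) \<or> ear_bottom n (4 * j + 2) (4 * Suc j)"
      unfolding ear_top_def ear_bottom_def by (cases "even j"; auto)+
    then have "T' (node (4 * j)) (node (4 * Suc j + i)) \<or> B' (node (4 * j)) (node (4 * Suc j + i))"
      "T' (node (4 * j + 2)) (node (4 * Suc j)) \<or> B' (node (4 * j + 2)) (node (4 * Suc j))"
      using T'_new[of "4 * j"] T'_new[of "4 * j + 2"] B'_new[of "4 * j"] B'_new[of "4 * j + 2"] j by auto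
    then show ?thesis
      using i node_code[of i "Suc j"] node_code[of 2 j] node_code0[of j] node_code0[of "Suc j"] by auto
  qed
  obtain m where m: "n = Suc m" using n(1) gr0_conv_Suc by auto
  have "node 0 = (us ! 0, 0)" "node 2 = (us ! 0, 2)" by (simp_all add: node_def)
  then have first: "T' (us ! 0, 0) (x, 0)" "T' (us ! 0, 2) (x, 0)" "B' (us ! 0, 0) (x, 2)"
    using T'_new[of 0 "(x, 0)"] T'_new[of 2 "(x, 0)"] B'_new[of 0 "(x, 2)"] n(1)
    unfolding XT_def XB_def by auto
  have last: "T' (us ! m, 2) (x, 0)" "B' (us ! m, 0) (x, 2)"
    using T'_new[of "4 * m + 2" "(x, 0)"] B'_new[of "4 * m" "(x, 2)"]
      node_code[of 2 m] node_code0[of m] unfolding XT_def XB_def m by auto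
  \<comment> \<open>The spare node has one arc on each page, so suppressing it gives the edge that
    closes the ear.\<close>
  have spare: "{y. T' (us ! m, 3) y \<or> B' (us ! m, 3) y} = {(us ! m, 0), (x, 0)}"
  proof -
    have "\<not> ear_top n (4 * m + 3) l" "\<not> ear_top n l (4 * m + 3)" for l
      unfolding ear_top_def ear_chain_def by (auto; presburger)+
    moreover have "ear_bottom n (4 * m + 3) l \<or> ear_bottom n l (4 * m + 3) \<longleftrightarrow> l = 4 * m" for l
      unfolding ear_bottom_def ear_chain_def m by (auto; presburger)
    moreover have "4 * m + 3 \<in> XT" "4 * m + 3 \<notin> XB" unfolding XT_def XB_def m by auto
    ultimately show ?thesis
      using T'_new[of "4 * m + 3"] B'_new[of "4 * m + 3"] node_code[of 3 m] node_code0[of m] m by auto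
  qed
  have m_us: "us ! m \<in> set us" using m unfolding n_def by simp
  have edges': "(T' (a, 0) (b, 2) \<or> B' (a, 0) (b, 2)) \<and>
      (T' (a, 0) (b, 0) \<or> B' (a, 0) (b, 0) \<or>
        (\<exists>w\<in>V \<union> set us. {y. T' (w, 3) y \<or> B' (w, 3) y} = {(a, 0), (b, 0)}))"
    if ab: "a \<in> V \<union> set us" "b \<in> V \<union> set us" "E a b" for a b
  proof (cases "a \<in> V \<and> b \<in> V")
    case True
    have "T' (w, 3) y \<longleftrightarrow> T (w, 3) y" "B' (w, 3) y \<longleftrightarrow> B (w, 3) y" if "w \<in> V" for w y
      using T'_old[of "(w, 3)"] B'_old[of "(w, 3)"] that unfolding N_def by auto
    then have spare_old: "{y. T' (w, 3) y \<or> B' (w, 3) y} = {y. T (w, 3) y \<or> B (w, 3) y}" if "w \<in> V" for w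
      using that by simp
    have "T' (a, 0) (b, 2) \<or> B' (a, 0) (b, 2)" using shadow_edge[of a b] True ab(3) mono by blast
    moreover consider "T (a, 0) (b, 0) \<or> B (a, 0) (b, 0)"
      | w where "w \<in> V" "{y. T (w, 3) y \<or> B (w, 3) y} = {(a, 0), (b, 0)}"
      using edge[of a b] True ab(3) by blast
    then have "T' (a, 0) (b, 0) \<or> B' (a, 0) (b, 0) \<or>
        (\<exists>w\<in>V \<union> set us. {y. T' (w, 3) y \<or> B' (w, 3) y} = {(a, 0), (b, 0)})"
    proof cases
      case 1
      then show ?thesis using mono by blast
    next
      case (2 w)
      have "{y. T' (w, 3) y \<or> B' (w, 3) y} = {(a, 0), (b, 0)}" using spare_old[OF 2(1)] 2(2) by (rule trans)
      moreover have "w \<in> V \<union> set us" using 2(1) by blast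
      ultimately show ?thesis by blast
    qed
    ultimately show ?thesis by blast
  next
    case False
    then have "{a, b} \<in> path_edges (x # us @ [x])" using new_edges ab by blast
    then obtain i where i: "{a, b} = {(x # us @ [x]) ! i, (x # us @ [x]) ! Suc i}" "i < Suc n"
      unfolding path_edges_conv_nth n_def by auto
    have nth: "(x # us @ [x]) ! Suc k = (if k < n then us ! k else x)" if "k \<le> n" for k
      using that by (auto simp: nth_append n_def)
    consider "{a, b} = {x, us ! 0}" | j where "{a, b} = {us ! j, us ! Suc j}" "Suc j < n" | "{a, b} = {us ! m, x}"
    proof (cases i)
      case 0
      then show ?thesis using that(1) i nth[of 0] n(1) by simp
    next
      case (Suc j)
      then show ?thesis using that(2)[of j] that(3) i nth[of j] nth[of "Suc j"] m by (cases "j = m") auto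
    qed
    then show ?thesis
    proof cases
      case 1
      then show ?thesis using first sym by (auto simp: doubleton_eq_iff)
    next
      case (2 j)
      then show ?thesis
        using consecutive[of j 0] consecutive[of j 2] sym by (auto simp: doubleton_eq_iff)
    next
      case 3
      then show ?thesis using last sym spare m_us by (auto simp: doubleton_eq_iff insert_commute)
    qed
  qed
  have "shadow_book (V \<union> set us) E pos' T' B'"
    by unfold_locales
      (rule inj' verts sym nc_T' nc_B' split' edges'[THEN conjunct1] edges'[THEN conjunct2]; assumption)+
  then show ?thesis by blast
qed

end

text \<open>The induction invariant: what is not yet drawn hangs off single vertices of
  \<open>W\<close>, so an ear that leaves \<open>W\<close> at \<open>x\<close> can only come back at
  \<open>x\<close>. Edges within \<open>W\<close> are allowed.\<close>

definition no_bypass :: "('a \<Rightarrow> 'a \<Rightarrow> bool) \<Rightarrow> 'a set \<Rightarrow> bool" where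
  "no_bypass E W \<longleftrightarrow> (\<forall>p A q. p \<in> W \<longrightarrow> q \<in> W \<longrightarrow> distinct (p # A @ [q]) \<longrightarrow>
     successively E (p # A @ [q]) \<longrightarrow> set A \<inter> W = {} \<longrightarrow> A = [])"

lemma no_bypassD:
  assumes "no_bypass E W" "p \<in> W" "q \<in> W" "distinct (p # A @ [q])" "successively E (p # A @ [q])" "set A \<inter> W = {}"
  shows "A = []"
  using assms unfolding no_bypass_def by blast

text \<open>Among the edges leaving \<open>W\<close>, one that lies on a cycle outside
  \<open>W\<close> has to bring the whole cycle along, because \<open>y\<close> alone would leave a
  bypass from \<open>x\<close> to \<open>y\<close>. That the larger set has no bypass then follows
  from the cactus property, as a path between two vertices of the cycle would create a second
  cycle.\<close>

lemma grow_shadow_book: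
  assumes graph: "simple_graph V E" and conn: "connected_graph V E" and "bipartite_cactus V E"
    and W: "W \<subseteq> V" "W \<noteq> {}" "W \<noteq> V" and W_nb: "no_bypass E W"
    and book: "shadow_book W E pos T B"
  obtains W' pos' T' B' where "W \<subset> W'" "W' \<subseteq> V" "no_bypass E W'" "shadow_book W' E pos' T' B'"
proof -
  have sym: "E u v \<Longrightarrow> E v u" and verts: "E u v \<Longrightarrow> u \<in> V \<and> v \<in> V \<and> u \<noteq> v" for u v
    using graph unfolding simple_graph_def by blast+
  have rev_walk: "successively E (rev xs)" if "successively E xs" for xs
    using successively_rev_sym[of E xs] sym that by blast
  have cactus: "cactus V E" and bip: "bipartite V E" using assms(3) unfolding bipartite_cactus_def by auto
  obtain x y where xy: "x \<in> W" "y \<notin> W" "E x y"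
  proof -
    obtain r z where rz: "r \<in> W" "z \<in> V" "z \<notin> W" using W by blast
    then have "(r, z) \<in> {(x, y). E x y}\<^sup>*" using conn W(1) unfolding connected_graph_def by blast
    then have "z \<in> W \<or> (\<exists>x y. x \<in> W \<and> y \<notin> W \<and> E x y)"
      by (induction rule: rtrancl_induct) (use rz in auto)
    then show thesis using that rz by blast
  qed
  \<comment> \<open>\<open>[y]\<close> is an ear as well, walking the edge to \<open>y\<close> back
    and forth; \<open>closed_ear\<close> singles out the genuine cycles through this edge.\<close>
  define ear where "ear us \<longleftrightarrow> distinct us \<and> set us \<inter> W = {} \<and> successively E (x # us @ [x])" for us
  define closed_ear where "closed_ear us \<longleftrightarrow> ear us \<and> length us \<ge> 2 \<and> hd us = y" for us
  obtain us where us: "ear us" "us \<noteq> []" "(us = [y] \<and> (\<nexists>vs. closed_ear vs)) \<or> length us \<ge> 2"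
  proof (cases "\<exists>vs. closed_ear vs")
    case True
    then show thesis using that unfolding closed_ear_def by fastforce
  next
    case False
    then show thesis using that[of "[y]"] xy sym unfolding ear_def by auto
  qed
  have d: "distinct us" "set us \<inter> W = {}" "successively E (x # us @ [x])" using us(1) unfolding ear_def by auto
  have walk_V: "set us \<subseteq> V"
  proof
    fix u assume "u \<in> set us"
    then obtain P S where "us = P @ u # S" by (meson split_list)
    then have "successively E ((x # P) @ u # S @ [x])" using d(3) by simp
    then have "E (last (x # P)) u" unfolding successively_append_iff by simp
    then show "u \<in> V" using verts by blast
  qed
  have cycle: "is_cycle E (x # us)" if "length us \<ge> 2"
    using d xy(1) that unfolding is_cycle_conv by auto
  have odd: "odd (length us)" using us(3) bipartite_cycle_even[OF bip cycle] by auto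
  have chord: False if "length us \<ge> 2" "p \<in> set (x # us)" "q \<in> set (x # us)" "distinct (p # A @ [q])"
    "successively E (p # A @ [q])" "set A \<inter> set (x # us) = {}" "A \<noteq> [] \<or> {p, q} \<notin> path_edges (x # us @ [x])" for p q A
    using cactus_no_chord_path[OF sym cactus cycle[OF that(1)] that(2-6)] that(7) by (simp add: cycle_edges_conv)
  have prefix: "successively E (x # P @ [u])" "successively E (u # rev P @ [x])" if "us = P @ u # S" for P u S
  proof -
    have "successively E ((x # P @ [u]) @ S @ [x])" using d(3) that by simp
    then show "successively E (x # P @ [u])" using successively_append_iff by blast
    then have "successively E (rev (x # P @ [u]))" by (rule rev_walk)
    then show "successively E (u # rev P @ [x])" by simp
  qed
  \<comment> \<open>Following the ear from \<open>x\<close> to \<open>u\<close> and then stepping to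
    \<open>z\<close> would bypass \<open>W\<close>.\<close>
  have attach: "z = x" if u: "u \<in> set us" and z: "z \<in> W" and uz: "E u z" for u z
  proof (rule ccontr)
    assume "z \<noteq> x"
    obtain P S where P: "us = P @ u # S" using u by (meson split_list)
    have "successively E ((x # P @ [u]) @ [z])"
      using prefix(1)[OF P] uz by (subst successively_append_iff) auto
    then have "P @ [u] = []"
      using d(1,2) z xy(1) \<open>z \<noteq> x\<close> P by (intro no_bypassD[OF W_nb xy(1) z]) auto
    then show False by simp
  qed
  have cyc_edge: "{a, b} \<in> path_edges (x # us @ [x])" if "E a b" "a \<in> set us" "b \<in> set (x # us)" for a b
    using us(3)
  proof
    assume "us = [y] \<and> (\<nexists>vs. closed_ear vs)"
    then show ?thesis using that verts[OF that(1)] by (auto simp: insert_commute)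
  next
    assume "length us \<ge> 2"
    then show ?thesis using chord[of a b "[]"] that verts[OF that(1)] by auto
  qed
  have new_edges: "{a, b} \<in> path_edges (x # us @ [x])"
    if ab: "E a b" "a \<in> W \<union> set us" "b \<in> W \<union> set us" "\<not> (a \<in> W \<and> b \<in> W)" for a b
  proof (cases "a \<in> set us")
    case True
    then show ?thesis using cyc_edge[OF ab(1) True] attach[OF True _ ab(1)] ab(3) by auto
  next
    case False
    then have "b \<in> set us" "a \<in> W" using ab by auto
    moreover have "a = x" using attach[OF \<open>b \<in> set us\<close> \<open>a \<in> W\<close> sym[OF ab(1)]] .
    ultimately show ?thesis using cyc_edge[OF sym[OF ab(1)]] by (simp add: insert_commute)
  qed
  \<comment> \<open>If \<open>p\<close> is not \<open>x\<close>, continuing from \<open>q\<close>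
    along the ear back to \<open>x\<close> bypasses the old \<open>W\<close>. If \<open>p\<close> is
    \<open>x\<close>, the path is a chord path of the new cycle, or, when only \<open>y\<close> was
    added, it closes up to an ear whose absence was assumed.\<close>
  have bypass_mixed: False
    if p: "p \<in> W" and q: "q \<in> set us" and A: "distinct (p # A @ [q])" "successively E (p # A @ [q])"
      "set A \<inter> (W \<union> set us) = {}" "A \<noteq> []" for p q A
  proof (cases "p = x")
    case False
    obtain P S where P: "us = P @ q # S" using q by (meson split_list)
    have "successively E ((p # A @ [q]) @ rev P @ [x])"
      using A(2) prefix(2)[OF P] successively_append_iff[of E "p # A @ [q]" "rev P @ [x]"]
        successively_Cons[of E q "rev P @ [x]"] by simp
    then have "A @ q # rev P = []"
      using d(1,2) xy(1) A False P p by (intro no_bypassD[OF W_nb p xy(1)]) auto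
    then show False by simp
  next
    case True
    show False
      using us(3)
    proof
      assume y: "us = [y] \<and> (\<nexists>vs. closed_ear vs)"
      have "successively E (x # A @ [y])" using A(2) True q y by simp
      then have "successively E (rev (x # A @ [y]))" by (rule rev_walk)
      then have "successively E (x # (y # rev A) @ [x])" using xy(3) by simp
      moreover have "length (y # rev A) \<ge> 2" using A(4) by (cases A) auto
      ultimately have "closed_ear (y # rev A)"
        unfolding closed_ear_def ear_def using A xy(2) q y by auto
      then show False using y by blast
    next
      assume "length us \<ge> 2"
      then show False using chord[of p q A] True q A xy(1) by auto
    qed
  qed
  have nb': "no_bypass E (W \<union> set us)"
    unfolding no_bypass_def
  proof (intro allI impI, rule ccontr)
    fix p A q
    assume h: "p \<in> W \<union> set us" "q \<in> W \<union> set us" "distinct (p # A @ [q])" "successively E (p # A @ [q])"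
      "set A \<inter> (W \<union> set us) = {}" "A \<noteq> []"
    have rev: "successively E (q # rev A @ [p])"
      using rev_walk[OF h(4)] by simp
    consider "p \<in> W" "q \<in> W" | "p \<in> W" "q \<in> set us" | "p \<in> set us" "q \<in> W" | "p \<in> set us" "q \<in> set us"
      using h(1,2) by blast
    then show False
    proof cases
      case 1
      then show ?thesis using no_bypassD[OF W_nb 1 h(3,4)] h(5,6) by blast
    next
      case 2
      then show ?thesis using bypass_mixed[OF 2 h(3-6)] by blast
    next
      case 3
      then show ?thesis using bypass_mixed[of q p "rev A"] rev h by auto
    next
      case 4
      show ?thesis
        using us(3)
      proof
        assume "us = [y] \<and> (\<nexists>vs. closed_ear vs)"
        then show False using 4 h(3) by auto
      next
        assume "length us \<ge> 2"
        then show False using chord[of p q A] 4 h xy(1) by auto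
      qed
    qed
  qed
  interpret shadow_book W E pos T B by (rule book)
  have fin: "finite W" using graph W(1) finite_subset unfolding simple_graph_def by blast
  obtain pos' T' B' where "shadow_book (W \<union> set us) E pos' T' B'"
  proof -
    consider "splits_shadow_edge T B x" | "splits_shadow_edge B T x" using splits[OF xy(1)] by blast
    then have "\<exists>pos' T' B'. shadow_book (W \<union> set us) E pos' T' B'"
    proof cases
      case 1
      then show ?thesis using add_ear[OF fin xy(1) 1 d(1,2) odd] new_edges by blast
    next
      case 2
      then show ?thesis using shadow_book.add_ear[OF swap fin xy(1) 2 d(1,2) odd] new_edges by blast
    qed
    then show thesis using that by blast
  qed
  moreover have "W \<subset> W \<union> set us" using us(2) d(2) by (cases us) auto
  ultimately show thesis using that nb' W(1) walk_V by blast
qed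

section \<open>Induction from a single vertex, and the equivalence\<close>

lemma single_shadow_book:
  assumes "\<not> E r r"
  shows "shadow_book {r} E (\<lambda>(v, i). real i) (\<lambda>a b. {a, b} = {(r, 0), (r, 1)}) (\<lambda>a b. {a, b} = {(r, 1), (r, 2)})"
proof
  show "noncrossing (\<lambda>(v, i). real i) (\<lambda>a b. {a, b} = {(r, 0), (r, 1)})"
    "noncrossing (\<lambda>(v, i). real i) (\<lambda>a b. {a, b} = {(r, 1), (r, 2)})"
    unfolding noncrossing_def by (auto simp: doubleton_eq_iff)
qed (use assms in \<open>auto simp: inj_on_def doubleton_eq_iff splits_shadow_edge_def\<close>)

lemma bipartite_cactus_imp_planar_shadow:
  assumes "simple_graph V E" "connected_graph V E" "bipartite_cactus V E"
  shows "planar (shadow_verts V) (shadow_adj V E)"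
proof -
  have extend: "\<exists>pos T B. shadow_book V E pos T B"
    if "W \<subseteq> V" "W \<noteq> {}" "no_bypass E W" "shadow_book W E pos T B" for W pos T B
    using that
  proof (induction "card (V - W)" arbitrary: W pos T B rule: less_induct)
    case less
    show ?case
    proof (cases "W = V")
      case True
      then show ?thesis using less.prems by blast
    next
      case False
      obtain W' pos' T' B' where W': "W \<subset> W'" "W' \<subseteq> V" "no_bypass E W'" "shadow_book W' E pos' T' B'"
        using grow_shadow_book[OF assms less.prems(1,2) False less.prems(3,4)] by metis
      have "finite V" using assms(1) unfolding simple_graph_def by blast
      then have "card (V - W') < card (V - W)" using W' by (intro psubset_card_mono) auto
      then show ?thesis using less.hyps[of W'] W' by blast
    qed
  qed
  obtain r where r: "r \<in> V" using assms(2) unfolding connected_graph_def by blast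
  have "\<not> E r r" using assms(1) unfolding simple_graph_def by blast
  moreover have "no_bypass E {r}" unfolding no_bypass_def by auto
  ultimately obtain pos T B where "shadow_book V E pos T B"
    using extend[OF _ _ _ single_shadow_book] r by blast
  then show ?thesis using shadow_book.shadow_planar assms(1) by blast
qed

theorem theorem1p1:
  fixes V :: "'a set" and E :: "'a \<Rightarrow> 'a \<Rightarrow> bool"
  assumes "simple_graph V E" and "connected_graph V E"
  shows "planar (shadow_verts V) (shadow_adj V E) \<longleftrightarrow> bipartite_cactus V E"
  using planar_shadow_imp_bipartite_cactus[OF assms] bipartite_cactus_imp_planar_shadow[OF assms] by blast

end
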